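(* Let $X$ be a splittable random process. Then the limit \[ \lim_{\substack{r\to\infty,\ \lambda\to 0\\ \lambda\log r\to 0}} \frac{1}{r\lambda^2}\log \mathbb{E}\exp\Big(\lambda\int_0^r X_t\,dt\Big) \] exists (as a finite real number). That is, there is a real number $L$ such that for every $\varepsilon>0$ there exist $R$ and $\delta>0$ such that \[ \Big|\frac{1}{r\lambda^2}\log \mathbb{E}\exp\Big(\lambda\int_0^r X_t\,dt\Big)-L\Big|\le\varepsilon \] for all $r\ge R$ and all real $\lambda\neq 0$ such that $|\lambda|\log r\le\delta$.
   Context: A (random) process $X$ is a two-parameter family of real random variables on a probability space, denoted $\big(\int_\alpha^\beta X_t\,dt\big)_{-\infty<\alpha<\beta<\infty}$ (only a notation; no individual random variables $X_t$ are required to exist), satisfying $\int_\alpha^\beta X_t\,dt+\int_\beta^\gamma X_t\,dt=\int_\alpha^\gamma X_t\,dt$ for $\alpha<\beta<\gamma$. Two processes $X,Y$ (possibly on different probability spaces) are identically distributed if the random vectors $\big(\int_{\alpha_1}^{\beta_1}X_t\,dt,\dots,\int_{\alpha_n}^{\beta_n}X_t\,dt\big)$ and $\big(\int_{\alpha_1}^{\beta_1}Y_t\,dt,\dots,\int_{\alpha_n}^{\beta_n}Y_t\,dt\big)$ are identically distributed whenever $\alpha_1<\beta_1,\dots,\alpha_n<\beta_n$. The process is stationary if time shifts, sending $\int_\alpha^\beta X_t\,dt$ to $\int_{\alpha+s}^{\beta+s}X_t\,dt$, are measure preserving (the shifted process is distributed like $X$ for every $s\in\mathbb{R}$). It is centered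 if $\mathbb{E}\big|\int_\alpha^\beta X_t\,dt\big|<\infty$ and $\mathbb{E}\int_\alpha^\beta X_t\,dt=0$ for all $\alpha<\beta$. The measurability condition is: $r\mapsto\mathbb{E}\,\varphi\big(\int_0^rX_t\,dt\big)$ is a measurable function of $r\in(0,\infty)$ for every bounded continuous $\varphi:\mathbb{R}\to\mathbb{R}$. The $\sigma$-field generated by a process is the one generated by all $\int_\alpha^\beta X_t\,dt$; independence of processes means independence of the generated $\sigma$-fields. A centered stationary process $X$ satisfying the measurability condition is splittable if there exist $r>0$ and $\varepsilon>0$ such that $\mathbb{E}\exp\big(\varepsilon\big|\int_0^rX_t\,dt\big|\big)<\infty$, and there exists (on some probability space) a triple of processes $X^0,X^-,X^+$ such that (a) the two processes $X^-,X^+$ are independent; (b) the four processes $X,X^0,X^-,X^+$ are identically distributed; (c) there exists a number $c>0$ such that for all $a,b>0$, \[ \mathbb{E}\exp\Big(c\Big|\int_{-a}^0X^-_t\,dt-\int_{-a}^0X^0_t\,dt\Big|+c\Big|\int_0^bX^+_t\,dt-\int_0^bX^0_t\,dt\Big|\Big)\le 2 . \] *)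

theory Defs
  imports "HOL-Probability.Probability"
begin

text \<open>
  A process is given by its increments: \<open>X \<alpha> \<beta>\<close> is the random variable written
  \<open>\<integral>\<^sub>\<alpha>\<^sup>\<beta> X\<^sub>t dt\<close>, and is meaningful only for \<open>\<alpha> < \<beta>\<close>; the values at other pairs are
  arbitrary and are never used below.
\<close>

type_synonym 'a process = "real \<Rightarrow> real \<Rightarrow> 'a \<Rightarrow> real"

text \<open>Equality of random variables is understood almost surely.\<close>

definition random_process :: "'a measure \<Rightarrow> 'a process \<Rightarrow> bool" where
  "random_process M X \<longleftrightarrow>
     prob_space M \<and>
     (\<forall>\<alpha> \<beta>. \<alpha> < \<beta> \<longrightarrow> X \<alpha> \<beta> \<in> borel_measurable M) \<and>
     (\<forall>\<alpha> \<beta> \<gamma>. \<alpha> < \<beta> \<and> \<beta> < \<gamma> \<longrightarrow> (AE \<omega> in M. X \<alpha> \<beta> \<omega> + X \<beta> \<gamma> \<omega> = X \<alpha> \<gamma> \<omega>))"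

definition identically_distributed ::
    "'a measure \<Rightarrow> 'a process \<Rightarrow> 'b measure \<Rightarrow> 'b process \<Rightarrow> bool" where
  "identically_distributed M X N Y \<longleftrightarrow>
     (\<forall>(n::nat) \<alpha> \<beta>. (\<forall>i<n. \<alpha> i < \<beta> i) \<longrightarrow>
        distr M (PiM {..<n} (\<lambda>_. borel)) (\<lambda>\<omega>. \<lambda>i\<in>{..<n}. X (\<alpha> i) (\<beta> i) \<omega>) =
        distr N (PiM {..<n} (\<lambda>_. borel)) (\<lambda>\<omega>. \<lambda>i\<in>{..<n}. Y (\<alpha> i) (\<beta> i) \<omega>))"

definition stationary_process :: "'a measure \<Rightarrow> 'a process \<Rightarrow> bool" where
  "stationary_process M X \<longleftrightarrow>
     (\<forall>s. identically_distributed M (\<lambda>\<alpha> \<beta>. X (\<alpha> + s) (\<beta> + s)) M X)"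

definition centered_process :: "'a measure \<Rightarrow> 'a process \<Rightarrow> bool" where
  "centered_process M X \<longleftrightarrow>
     (\<forall>\<alpha> \<beta>. \<alpha> < \<beta> \<longrightarrow> integrable M (X \<alpha> \<beta>) \<and> (\<integral>\<omega>. X \<alpha> \<beta> \<omega> \<partial>M) = 0)"

text \<open>Measurability in \<open>r\<close> is Lebesgue measurability, which is implied by Borel measurability.\<close>

definition measurability_condition :: "'a measure \<Rightarrow> 'a process \<Rightarrow> bool" where
  "measurability_condition M X \<longleftrightarrow>
     (\<forall>\<phi> :: real \<Rightarrow> real. continuous_on UNIV \<phi> \<and> bounded (range \<phi>) \<longrightarrow>
        (\<lambda>r. \<integral>\<omega>. \<phi> (X 0 r \<omega>) \<partial>M) \<in> borel_measurable (lebesgue_on {0<..}))"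

definition process_sigma_field :: "'a measure \<Rightarrow> 'a process \<Rightarrow> 'a set set" where
  "process_sigma_field M X =
     sigma_sets (space M) {X \<alpha> \<beta> -` B \<inter> space M | \<alpha> \<beta> B. \<alpha> < \<beta> \<and> B \<in> sets borel}"

definition independent_processes :: "'a measure \<Rightarrow> 'a process \<Rightarrow> 'a process \<Rightarrow> bool" where
  "independent_processes M X Y \<longleftrightarrow>
     prob_space.indep_set M (process_sigma_field M X) (process_sigma_field M Y)"

text \<open>
  HOL cannot quantify existentially over the type of the sample points of the probability space
  carrying \<open>X0\<close>, \<open>Xm\<close>, \<open>Xp\<close> (that is, \<open>X\<^sup>0\<close>, \<open>X\<^sup>-\<close>, \<open>X\<^sup>+\<close>), so this type is a parameter. In a
  theorem that assumes splittability, a free type variable in its place amounts to existence on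
  an arbitrary probability space. Exponential moments are nonnegative integrals, so that
  their finiteness is part of the condition.
\<close>

definition splittable :: "'b itself \<Rightarrow> 'a measure \<Rightarrow> 'a process \<Rightarrow> bool" where
  "splittable (_ :: 'b itself) M X \<longleftrightarrow>
     random_process M X \<and> centered_process M X \<and> stationary_process M X \<and>
     measurability_condition M X \<and>
     (\<exists>r>0. \<exists>\<epsilon>>0. (\<integral>\<^sup>+\<omega>. ennreal (exp (\<epsilon> * \<bar>X 0 r \<omega>\<bar>)) \<partial>M) < \<infinity>) \<and>
     (\<exists>(N :: 'b measure) X0 Xm Xp.
        random_process N X0 \<and> random_process N Xm \<and> random_process N Xp \<and>
        independent_processes N Xm Xp \<and>
        identically_distributed M X N X0 \<and>
        identically_distributed M X N Xm \<and>
        identically_distributed M X N Xp \<and>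
        (\<exists>c>0. \<forall>a>0. \<forall>b>0.
           (\<integral>\<^sup>+\<omega>. ennreal (exp (c * \<bar>Xm (- a) 0 \<omega> - X0 (- a) 0 \<omega>\<bar> +
                                c * \<bar>Xp 0 b \<omega> - X0 0 b \<omega>\<bar>)) \<partial>N) \<le> 2))"

end

theory Submission
  imports Defs
begin

text \<open>
  Let \<open>f r \<lambda>\<close> be the logarithm of \<open>E exp (\<lambda> S r)\<close>, where \<open>S r\<close> is the increment over \<open>[0, r]\<close>.
  Splittability says that \<open>S (a + b)\<close> is the sum of independent copies of \<open>S a\<close> and \<open>S b\<close> and of
  a centered error with a uniformly bounded exponential moment. Hoelder's inequality with exponents
  \<open>1 + \<theta>\<close> and \<open>1 + 1 / \<theta>\<close> turns this into two-sided bounds between \<open>f (a + b) \<lambda>\<close> and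
  \<open>f a ((1 + \<theta>) \<lambda>) + f b ((1 + \<theta>) \<lambda>)\<close>, with an error of order \<open>\<lambda>\<^sup>2 / \<theta>\<close>. As \<open>\<lambda> \<rightarrow> 0\<close> they show that
  the variance of \<open>S r\<close> divided by \<open>r\<close> converges. Iterating them over the scales \<open>r, r / 2, r / 4, \<dots>\<close>
  down to a large but fixed length, with \<open>\<theta>\<close> decreasing geometrically in the length and bounded
  below by a multiple of \<open>\<bar>\<lambda>\<bar>\<close>, carries the quadratic approximation of \<open>f\<close> from the fixed length
  to the length \<open>r\<close>. The number of scales is of order \<open>ln r\<close>, which explains the condition on
  \<open>\<lambda> ln r\<close>.
\<close>

section \<open>Almost additive cumulant generating functions\<close>

text \<open>The infimum of the right-hand side over \<open>\<theta>\<close> is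
  \<open>(sqrt x + sqrt C)^2\<close>, attained at \<open>\<theta> = sqrt C / sqrt x\<close>. For
  \<open>x = 0\<close> it is only approached as \<open>\<theta>\<close> grows, hence the separate
  case with slack \<open>e\<close>.\<close>

lemma sqrt_le_add_sqrt:
  fixes x y C :: real
  assumes "0 \<le> x" "0 < C" and y: "\<And>\<theta>. 0 < \<theta> \<Longrightarrow> y \<le> (1 + \<theta>) * x + C * (1 + 1 / \<theta>)"
  shows "sqrt y \<le> sqrt x + sqrt C"
proof (cases "x = 0")
  case True
  have "y \<le> C + e" if "0 < e" for e
  proof -
    have "C * (1 + 1 / (C / e)) = C + e" using that \<open>0 < C\<close> by (simp add: field_simps)
    then show ?thesis using y[of "C / e"] that \<open>0 < C\<close> True by simp
  qed
  then have "y \<le> C" by (rule field_le_epsilon)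
  then show ?thesis using True by simp
next
  case False
  define X D where "X = sqrt x" and "D = sqrt C"
  have pos: "0 < X" "0 < D" and x: "x = X\<^sup>2" and C: "C = D\<^sup>2"
    using assms False by (auto simp: X_def D_def)
  have "(1 + D / X) * X\<^sup>2 + D\<^sup>2 * (1 + 1 / (D / X)) = (X + D)\<^sup>2"
    using pos by (simp add: field_simps power2_eq_square)
  with y[of "D / X"] have "y \<le> (X + D)\<^sup>2"
    using pos by (simp add: x C)
  then have "sqrt y \<le> X + D"
    using pos by (intro real_le_lsqrt) auto
  then show ?thesis by (simp add: X_def D_def)
qed

text \<open>Cauchy's functional equation: nonnegativity makes \<open>V\<close> monotone, and placing
  a multiple of \<open>a\<close> between consecutive integers leaves an error that vanishes as the
  multiple grows.\<close>

lemma nonneg_additive_linear: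
  fixes V :: "real \<Rightarrow> real"
  assumes nonneg: "\<And>a. 0 < a \<Longrightarrow> 0 \<le> V a"
    and add: "\<And>a b. 0 < a \<Longrightarrow> 0 < b \<Longrightarrow> V (a + b) = V a + V b"
    and "0 < a"
  shows "V a = a * V 1"
proof -
  have mono: "V x \<le> V y" if "0 < x" "x \<le> y" for x y
    using add[of x "y - x"] nonneg[of "y - x"] that by (cases "x = y") auto
  have mult: "V (real (Suc n) * x) = real (Suc n) * V x" if "0 < x" for n x
  proof (induction n)
    case (Suc n)
    have "V (real (Suc (Suc n)) * x) = V (real (Suc n) * x + x)" by (simp add: algebra_simps)
    also have "\<dots> = V (real (Suc n) * x) + V x" using that by (intro add) auto
    finally show ?case using Suc by (simp add: algebra_simps)
  qed simp
  have bound: "\<bar>V a - a * V 1\<bar> \<le> V 1 / real (Suc N)" if N: "1 \<le> real (Suc N) * a" for N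
  proof -
    \<comment> \<open>\<open>Suc m\<close> is the floor of \<open>real (Suc N) * a\<close>, which is
      at least 1 by the choice of \<open>N\<close>; the shift matches \<open>mult\<close>, which is
      about positive multiples.\<close>
    define m where "m = nat \<lfloor>real (Suc N) * a\<rfloor> - 1"
    have m: "real (Suc m) \<le> real (Suc N) * a" "real (Suc N) * a \<le> real (Suc m) + 1"
      using N unfolding m_def by linarith+
    have "real (Suc m) * V 1 \<le> real (Suc N) * V a"
      using mono[OF _ m(1)] mult[of 1 m] mult[OF \<open>0 < a\<close>, of N] by simp
    moreover have "real (Suc N) * V a \<le> real (Suc (Suc m)) * V 1"
      using mono[of "real (Suc N) * a" "real (Suc (Suc m))"] m mult[of 1 "Suc m"]
        mult[OF \<open>0 < a\<close>, of N] \<open>0 < a\<close> by simp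
    moreover have "real (Suc m) * V 1 \<le> real (Suc N) * a * V 1"
      "real (Suc N) * a * V 1 \<le> (real (Suc m) + 1) * V 1"
      using m nonneg[of 1] by (intro mult_right_mono; simp)+
    ultimately have "\<bar>real (Suc N) * V a - real (Suc N) * a * V 1\<bar> \<le> V 1"
      by (simp add: algebra_simps)
    also have "real (Suc N) * V a - real (Suc N) * a * V 1 = real (Suc N) * (V a - a * V 1)"
      by (simp add: algebra_simps)
    finally have "real (Suc N) * \<bar>V a - a * V 1\<bar> \<le> V 1" by (simp only: abs_mult abs_of_nat)
    then show ?thesis by (simp add: pos_le_divide_eq mult.commute del: of_nat_Suc)
  qed
  obtain N0 where N0: "1 < real N0 * a" using reals_Archimedean3[OF \<open>0 < a\<close>] by blast
  have "\<bar>V a - a * V 1\<bar> \<le> 0"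
  proof (rule tendsto_lowerbound)
    show "(\<lambda>N. V 1 / real (Suc N)) \<longlonglongrightarrow> 0"
      using LIMSEQ_Suc[OF lim_const_over_n] by simp
    have "1 \<le> real (Suc N) * a" if "N0 \<le> N" for N
    proof -
      have "real N0 * a \<le> real (Suc N) * a" using that \<open>0 < a\<close> by (intro mult_right_mono) auto
      then show ?thesis using N0 by linarith
    qed
    then show "\<forall>\<^sub>F N in sequentially. \<bar>V a - a * V 1\<bar> \<le> V 1 / real (Suc N)"
      unfolding eventually_sequentially using bound by blast
  qed simp
  then show ?thesis by simp
qed

lemma geometric_steps_convergent:
  fixes z :: "nat \<Rightarrow> real"
  assumes step: "\<And>n. \<bar>z (Suc n) - z n\<bar> \<le> D * \<rho> ^ n" and "0 \<le> \<rho>" "\<rho> < 1"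
  shows "convergent z" "\<bar>lim z - z 0\<bar> \<le> D / (1 - \<rho>)"
proof -
  have sums: "(\<lambda>n. D * \<rho> ^ n) sums (D * (1 / (1 - \<rho>)))"
    using assms by (intro sums_mult geometric_sums) auto
  have summ: "summable (\<lambda>n. z (Suc n) - z n)"
    by (rule summable_comparison_test'[OF sums_summable[OF sums]]) (use step in auto)
  have "(\<lambda>n. z 0 + (\<Sum>k<n. z (Suc k) - z k)) \<longlonglongrightarrow> z 0 + (\<Sum>k. z (Suc k) - z k)"
    using summ by (intro tendsto_intros summable_LIMSEQ)
  then have lim: "z \<longlonglongrightarrow> z 0 + (\<Sum>k. z (Suc k) - z k)"
    by (simp add: sum_lessThan_telescope)
  then show "convergent z" by (rule convergentI)
  have "\<bar>lim z - z 0\<bar> = \<bar>\<Sum>k. z (Suc k) - z k\<bar>"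
    using limI[OF lim] by simp
  also have "\<dots> \<le> (\<Sum>k. D * \<rho> ^ k)"
    using norm_suminf_le[OF _ sums_summable[OF sums], of "\<lambda>n. z (Suc n) - z n"] step by simp
  also have "\<dots> = D / (1 - \<rho>)" by (simp only: sums_unique[OF sums, symmetric] mult_1_right times_divide_eq_right)
  finally show "\<bar>lim z - z 0\<bar> \<le> D / (1 - \<rho>)" .
qed

text \<open>
  \<open>f r lam\<close> stands for the logarithm of \<open>E exp (lam S r)\<close>, and \<open>fin r lam\<close> says that this
  expectation is finite.
\<close>

lemma rescale_quotient:
  fixes p :: real
  assumes "p \<noteq> 0"
  shows "2 * F / p / (2 * a * lam\<^sup>2) = p * (F / (a * (p * lam)\<^sup>2))"
    and "F / p / (2 * a * lam\<^sup>2) = p * (F / (2 * a * (p * lam)\<^sup>2))"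
  using assms by (simp_all add: power2_eq_square)

text \<open>The last two assumptions have the shape of Hoelder bounds: the exponent
  \<open>1 + \<theta>\<close> multiplies the argument of the main term, and
  \<open>1 + 1 / \<theta>\<close> that of the error, whose exponential moment is controlled only
  near 0. This is the source of the smallness condition on \<open>\<bar>lam\<bar>\<close>.\<close>

locale almost_additive_cgf =
  fixes f :: "real \<Rightarrow> real \<Rightarrow> real" and fin :: "real \<Rightarrow> real \<Rightarrow> bool" and C c :: real
  assumes C_pos: "0 < C" and c_pos: "0 < c"
    and nonneg: "\<And>r lam. 0 < r \<Longrightarrow> fin r lam \<Longrightarrow> 0 \<le> f r lam"
    and upper: "\<And>a b \<theta> lam. \<lbrakk>0 < a; 0 < b; 0 < \<theta>; \<bar>lam\<bar> * (1 + 1 / \<theta>) \<le> c;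
        fin a ((1 + \<theta>) * lam); fin b ((1 + \<theta>) * lam)\<rbrakk> \<Longrightarrow>
        fin (a + b) lam \<and> f (a + b) lam \<le>
          (f a ((1 + \<theta>) * lam) + f b ((1 + \<theta>) * lam)) / (1 + \<theta>) + C * (1 + 1 / \<theta>) * lam\<^sup>2"
    and lower: "\<And>a b \<theta> lam. \<lbrakk>0 < a; 0 < b; 0 < \<theta>; \<bar>lam\<bar> * (1 + 1 / \<theta>) \<le> c;
        fin (a + b) ((1 + \<theta>) * lam)\<rbrakk> \<Longrightarrow>
        fin a lam \<and> fin b lam \<and> f a lam + f b lam \<le>
          f (a + b) ((1 + \<theta>) * lam) / (1 + \<theta>) + C * (1 + 1 / \<theta>) * lam\<^sup>2"
begin

text \<open>
  Since \<open>f\<close> is nonnegative, the lower estimate bounds the summand \<open>f a\<close> alone by \<open>f (a + b)\<close>;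
  this makes the bound uniform over all lengths below a given one.
\<close>

lemma locally_uniform_bound:
  assumes "0 < r0" "0 < t" and init: "\<And>lam. \<bar>lam\<bar> \<le> t \<Longrightarrow> fin r0 lam \<and> f r0 lam \<le> \<kappa>"
  shows "\<exists>s>0. \<exists>K. \<forall>r lam. 0 < r \<and> r \<le> R \<and> \<bar>lam\<bar> \<le> s \<longrightarrow> fin r lam \<and> f r lam \<le> K"
proof -
  have doubling: "\<exists>s>0. \<exists>K. \<forall>lam. \<bar>lam\<bar> \<le> s \<longrightarrow> fin (2 ^ n * r0) lam \<and> f (2 ^ n * r0) lam \<le> K" for n :: nat
  proof (induction n)
    case 0
    then show ?case using init \<open>0 < t\<close> by (intro exI[of _ t] conjI exI[of _ \<kappa>]) auto
  next
    case (Suc n)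
    then obtain s K where "0 < s"
      and IH: "\<And>lam. \<bar>lam\<bar> \<le> s \<Longrightarrow> fin (2 ^ n * r0) lam \<and> f (2 ^ n * r0) lam \<le> K" by blast
    \<comment> \<open>With \<open>\<theta> = 1\<close> a doubling of the length evaluates the
      shorter block at \<open>2 * lam\<close>, which costs half of the range; \<open>c / 2\<close>
      serves the smallness condition.\<close>
    define s' where "s' = min (s / 2) (c / 2)"
    have "fin (2 ^ Suc n * r0) lam \<and> f (2 ^ Suc n * r0) lam \<le> K + 2 * C * s'\<^sup>2" if "\<bar>lam\<bar> \<le> s'" for lam
    proof -
      have l: "\<bar>2 * lam\<bar> \<le> s" "\<bar>lam\<bar> * (1 + 1 / 1) \<le> c" using that by (auto simp: s'_def)
      have "lam\<^sup>2 \<le> s'\<^sup>2" using that by (metis abs_ge_zero power2_abs power_mono)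
      then have "2 * C * lam\<^sup>2 \<le> 2 * C * s'\<^sup>2" using C_pos by (intro mult_left_mono) auto
      then show ?thesis
        using upper[of "2 ^ n * r0" "2 ^ n * r0" 1 lam, folded mult_2] IH[OF l(1)] l(2) \<open>0 < r0\<close>
        by (simp add: mult.assoc)
    qed
    then show ?case using \<open>0 < s\<close> c_pos
      by (intro exI[of _ s'] conjI exI[of _ "K + 2 * C * s'\<^sup>2"]) (auto simp: s'_def)
  qed
  obtain n :: nat where n: "R / r0 < 2 ^ n" using real_arch_pow[of 2] by auto
  then have n: "R < 2 ^ n * r0" using \<open>0 < r0\<close> by (simp add: field_simps)
  obtain s K where "0 < s" and
    sK: "\<And>lam. \<bar>lam\<bar> \<le> s \<Longrightarrow> fin (2 ^ n * r0) lam \<and> f (2 ^ n * r0) lam \<le> K"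
    using doubling[of n] by blast
  define s' where "s' = min (s / 2) (c / 2)"
  have "fin r lam \<and> f r lam \<le> K / 2 + 2 * C * s'\<^sup>2" if "\<bar>lam\<bar> \<le> s'" "0 < r" "r \<le> R" for r lam
  proof -
    have l: "\<bar>2 * lam\<bar> \<le> s" "\<bar>lam\<bar> * (1 + 1 / 1) \<le> c" using that by (auto simp: s'_def)
    have "lam\<^sup>2 \<le> s'\<^sup>2" using that by (metis abs_ge_zero power2_abs power_mono)
    then have "2 * C * lam\<^sup>2 \<le> 2 * C * s'\<^sup>2" using C_pos by (intro mult_left_mono) auto
    then show ?thesis
      using lower[of r "2 ^ n * r0 - r" 1 lam] nonneg[of "2 ^ n * r0 - r" lam] sK[OF l(1)] l(2) n that
      by auto
  qed
  then show ?thesis using \<open>0 < s\<close> c_pos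
    by (intro exI[of _ s'] conjI exI[of _ "K / 2 + 2 * C * s'\<^sup>2"]) (auto simp: s'_def)
qed

section \<open>The normalised quotient under doubling of the length\<close>

text \<open>Because of the square, passing from \<open>lam\<close> to
  \<open>(1 + \<theta>) * lam\<close> turns the prefactor \<open>1 / (1 + \<theta>)\<close> of the
  Hoelder bounds into \<open>1 + \<theta>\<close>.\<close>

definition g :: "real \<Rightarrow> real \<Rightarrow> real" where
  "g r lam = f r lam / (r * lam\<^sup>2)"

lemma error_term_le:
  assumes "0 < a" "0 < \<theta>" "\<theta> \<le> (1::real)"
  shows "C * (1 + 1 / \<theta>) / (2 * a) \<le> C / (a * \<theta>)"
proof -
  have "C * (1 + 1 / \<theta>) / (2 * a) = C * (\<theta> + 1) / (2 * a * \<theta>)"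
    using assms by (simp add: field_simps)
  also have "\<dots> \<le> C * 2 / (2 * a * \<theta>)"
    using assms C_pos by (intro divide_right_mono mult_left_mono) auto
  finally show ?thesis by simp
qed

lemma abs_mult_one_plus_inverse_le:
  assumes "0 < \<theta>" "\<theta> \<le> 1" "2 * \<bar>lam\<bar> \<le> c * \<theta>"
  shows "\<bar>lam\<bar> * (1 + 1 / \<theta>) \<le> c"
proof -
  have "\<bar>lam\<bar> * (\<theta> + 1) \<le> \<bar>lam\<bar> * 2" using assms by (intro mult_left_mono) auto
  then have "\<bar>lam\<bar> * (\<theta> + 1) \<le> c * \<theta>" using assms by linarith
  then show ?thesis using assms by (simp add: field_simps)
qed

text \<open>Two equal halves in \<open>upper\<close>, divided by \<open>2 * a * lam^2\<close>; for
  \<open>\<theta> \<le> 1\<close> the smallness condition follows from the linear one assumed here.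
  The reverse bound \<open>g_le_double\<close> comes from \<open>lower\<close> in the same
  way.\<close>

lemma g_double_le:
  assumes "0 < a" "0 < \<theta>" "\<theta> \<le> 1" "lam \<noteq> 0" "2 * \<bar>lam\<bar> \<le> c * \<theta>" "fin a ((1 + \<theta>) * lam)"
  shows "fin (2 * a) lam \<and> g (2 * a) lam \<le> (1 + \<theta>) * g a ((1 + \<theta>) * lam) + C / (a * \<theta>)"
proof -
  have U: "fin (2 * a) lam"
    "f (2 * a) lam \<le> 2 * f a ((1 + \<theta>) * lam) / (1 + \<theta>) + C * (1 + 1 / \<theta>) * lam\<^sup>2"
    using upper[of a a \<theta> lam, folded mult_2] abs_mult_one_plus_inverse_le[of \<theta> lam] assms by simp_all
  have "g (2 * a) lam \<le> (2 * f a ((1 + \<theta>) * lam) / (1 + \<theta>) + C * (1 + 1 / \<theta>) * lam\<^sup>2) / (2 * a * lam\<^sup>2)"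
    unfolding g_def using U(2) assms by (intro divide_right_mono) auto
  also have "\<dots> = (1 + \<theta>) * g a ((1 + \<theta>) * lam) + C * (1 + 1 / \<theta>) / (2 * a)"
  proof -
    have "1 + \<theta> \<noteq> 0" using assms by auto
    note rescale_quotient(1)[OF this]
    moreover have "C * (1 + 1 / \<theta>) * lam\<^sup>2 / (2 * a * lam\<^sup>2) = C * (1 + 1 / \<theta>) / (2 * a)"
      using assms by simp
    ultimately show ?thesis by (simp only: g_def add_divide_distrib)
  qed
  finally show ?thesis using U(1) error_term_le[of a \<theta>] assms by linarith
qed

lemma g_le_double:
  assumes "0 < a" "0 < \<theta>" "\<theta> \<le> 1" "lam \<noteq> 0" "2 * \<bar>lam\<bar> \<le> c * \<theta>" "fin (2 * a) ((1 + \<theta>) * lam)"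
  shows "fin a lam \<and> g a lam \<le> (1 + \<theta>) * g (2 * a) ((1 + \<theta>) * lam) + C / (a * \<theta>)"
proof -
  have U: "fin a lam"
    "2 * f a lam \<le> f (2 * a) ((1 + \<theta>) * lam) / (1 + \<theta>) + C * (1 + 1 / \<theta>) * lam\<^sup>2"
    using lower[of a a \<theta> lam, folded mult_2] abs_mult_one_plus_inverse_le[of \<theta> lam] assms by simp_all
  have "g a lam = 2 * f a lam / (2 * a * lam\<^sup>2)" by (simp add: g_def)
  also have "\<dots> \<le> (f (2 * a) ((1 + \<theta>) * lam) / (1 + \<theta>) + C * (1 + 1 / \<theta>) * lam\<^sup>2) / (2 * a * lam\<^sup>2)"
    using U(2) assms by (intro divide_right_mono) auto
  also have "\<dots> = (1 + \<theta>) * g (2 * a) ((1 + \<theta>) * lam) + C * (1 + 1 / \<theta>) / (2 * a)"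
  proof -
    have "1 + \<theta> \<noteq> 0" using assms by auto
    note rescale_quotient(2)[OF this]
    moreover have "C * (1 + 1 / \<theta>) * lam\<^sup>2 / (2 * a * lam\<^sup>2) = C * (1 + 1 / \<theta>) / (2 * a)"
      using assms by simp
    ultimately show ?thesis by (simp only: g_def add_divide_distrib)
  qed
  finally show ?thesis using U(1) error_term_le[of a \<theta>] assms by linarith
qed

text \<open>Each halving of the length multiplies the argument by some
  \<open>1 + \<theta> k\<close>, so at the base length it has become \<open>P * lam\<close>.
  Smallness is demanded for this largest argument and thus covers the intermediate ones; each
  additive error is multiplied by a partial product, at most \<open>P\<close>.\<close>

lemma g_pow2_le:
  assumes "0 < h" and \<theta>: "\<And>k. k < n \<Longrightarrow> 0 < \<theta> k \<and> \<theta> k \<le> 1"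
    and "lam \<noteq> 0" and "P = (\<Prod>k<n. 1 + \<theta> k)"
    and "\<And>k. k < n \<Longrightarrow> 2 * (\<bar>lam\<bar> * P) \<le> c * \<theta> k"
    and "fin h (P * lam)"
  shows "fin (2 ^ n * h) lam \<and>
    g (2 ^ n * h) lam \<le> P * (g h (P * lam) + (\<Sum>k<n. C / (2 ^ k * h * \<theta> k)))"
  using assms
proof (induction n arbitrary: lam P)
  case (Suc n)
  define Q where "Q = (\<Prod>k<n. 1 + \<theta> k)"
  have Q1: "1 \<le> Q" unfolding Q_def using Suc.prems(2) by (intro prod_ge_1) (auto simp: less_imp_le)
  have t: "0 < \<theta> n" "\<theta> n \<le> 1" using Suc.prems(2)[of n] by auto
  have P: "P = Q * (1 + \<theta> n)" using Suc.prems(4) by (simp add: Q_def)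
  have P1: "1 * 1 \<le> P" unfolding P using Q1 t by (intro mult_mono) auto
  let ?\<mu> = "(1 + \<theta> n) * lam"
  \<comment> \<open>The largest scale is peeled off and the induction hypothesis is used at
    \<open>?\<mu>\<close>. The argument reached at the base length is still \<open>P * lam\<close>,
    so smallness and finiteness carry over.\<close>
  have mu: "\<bar>?\<mu>\<bar> * Q = \<bar>lam\<bar> * P" "Q * ?\<mu> = P * lam" using t by (simp_all add: P abs_mult)
  have "fin (2 ^ n * h) ?\<mu> \<and>
    g (2 ^ n * h) ?\<mu> \<le> Q * (g h (Q * ?\<mu>) + (\<Sum>k<n. C / (2 ^ k * h * \<theta> k)))"
  proof (rule Suc.IH[OF _ _ _ Q_def])
    show "2 * (\<bar>?\<mu>\<bar> * Q) \<le> c * \<theta> k" if "k < n" for k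
      unfolding mu(1) using Suc.prems(5) that by simp
    show "fin h (Q * ?\<mu>)" unfolding mu(2) by (rule Suc.prems(6))
    show "?\<mu> \<noteq> 0" using Suc.prems(3) t by auto
  qed (use Suc.prems(1,2) in auto)
  then have IH: "fin (2 ^ n * h) ?\<mu>"
    "g (2 ^ n * h) ?\<mu> \<le> Q * (g h (P * lam) + (\<Sum>k<n. C / (2 ^ k * h * \<theta> k)))"
    using mu by auto
  have "\<bar>lam\<bar> * 1 \<le> \<bar>lam\<bar> * P" using P1 by (intro mult_left_mono) auto
  then have "2 * \<bar>lam\<bar> \<le> c * \<theta> n" using Suc.prems(5)[of n] by simp
  then have step: "fin (2 * (2 ^ n * h)) lam"
    "g (2 * (2 ^ n * h)) lam \<le> (1 + \<theta> n) * g (2 ^ n * h) ?\<mu> + C / (2 ^ n * h * \<theta> n)"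
    using g_double_le[of "2 ^ n * h" "\<theta> n" lam] IH(1) t Suc.prems by auto
  have "(1 + \<theta> n) * g (2 ^ n * h) ?\<mu> \<le>
      (1 + \<theta> n) * (Q * (g h (P * lam) + (\<Sum>k<n. C / (2 ^ k * h * \<theta> k))))"
    using IH(2) t by (intro mult_left_mono) auto
  moreover have "1 * (C / (2 ^ n * h * \<theta> n)) \<le> P * (C / (2 ^ n * h * \<theta> n))"
    using P1 C_pos t \<open>0 < h\<close> by (intro mult_right_mono) auto
  ultimately have "g (2 * (2 ^ n * h)) lam \<le> P * (g h (P * lam) + (\<Sum>k<Suc n. C / (2 ^ k * h * \<theta> k)))"
    using step(2) by (simp add: P algebra_simps)
  then show ?case using step(1) by (simp add: mult.assoc)
qed simp

text \<open>The mirror image of \<open>g_pow2_le\<close>: the argument now grows with the length,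
  from \<open>lam\<close> at the base to \<open>P * lam\<close> at the top. As the base argument
  stays fixed, only \<open>P\<close> is generalised in the induction.\<close>

lemma g_le_pow2:
  assumes "0 < h" and \<theta>: "\<And>k. k < n \<Longrightarrow> 0 < \<theta> k \<and> \<theta> k \<le> 1"
    and "lam \<noteq> 0" and "P = (\<Prod>k<n. 1 + \<theta> k)"
    and "\<And>k. k < n \<Longrightarrow> 2 * (\<bar>lam\<bar> * P) \<le> c * \<theta> k"
    and "fin (2 ^ n * h) (P * lam)"
  shows "fin h lam \<and>
    g h lam \<le> P * (g (2 ^ n * h) (P * lam) + (\<Sum>k<n. C / (2 ^ k * h * \<theta> k)))"
  using assms
proof (induction n arbitrary: P)
  case (Suc n)
  define Q where "Q = (\<Prod>k<n. 1 + \<theta> k)"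
  have Q1: "1 \<le> Q" unfolding Q_def using Suc.prems(2) by (intro prod_ge_1) (auto simp: less_imp_le)
  have t: "0 < \<theta> n" "\<theta> n \<le> 1" using Suc.prems(2)[of n] by auto
  have P: "P = Q * (1 + \<theta> n)" using Suc.prems(4) by (simp add: Q_def)
  have "Q * 1 \<le> P" unfolding P using Q1 t by (intro mult_left_mono) auto
  then have QP: "\<bar>lam\<bar> * Q \<le> \<bar>lam\<bar> * P" by (intro mult_left_mono) auto
  have absQ: "\<bar>Q * lam\<bar> = \<bar>lam\<bar> * Q" using Q1 by (simp add: abs_mult)
  have mu: "(1 + \<theta> n) * (Q * lam) = P * lam" by (simp add: P)
  have "2 * \<bar>Q * lam\<bar> \<le> c * \<theta> n" using Suc.prems(5)[of n] QP absQ by simp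
  moreover have "fin (2 * (2 ^ n * h)) (P * lam)" using Suc.prems(6) by (simp add: mult.assoc)
  \<comment> \<open>The last doubling takes place at the argument \<open>Q * lam\<close>; the
    finiteness it yields there is the one that the induction hypothesis asks for.\<close>
  ultimately have step: "fin (2 ^ n * h) (Q * lam)"
    "g (2 ^ n * h) (Q * lam) \<le> (1 + \<theta> n) * g (2 * (2 ^ n * h)) (P * lam) + C / (2 ^ n * h * \<theta> n)"
    using g_le_double[of "2 ^ n * h" "\<theta> n" "Q * lam"] t Suc.prems(1,3) Q1 unfolding mu by auto
  have "2 * (\<bar>lam\<bar> * Q) \<le> c * \<theta> k" if "k < n" for k
    using Suc.prems(5)[of k] QP that by simp
  then have IH: "fin h lam"
    "g h lam \<le> Q * (g (2 ^ n * h) (Q * lam) + (\<Sum>k<n. C / (2 ^ k * h * \<theta> k)))"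
    using Suc.IH[of Q] Suc.prems step(1) by (auto simp: Q_def)
  let ?G = "g (2 * (2 ^ n * h)) (P * lam)" and ?E = "\<Sum>k<n. C / (2 ^ k * h * \<theta> k)"
  let ?e = "C / (2 ^ n * h * \<theta> n)"
  have "Q * (g (2 ^ n * h) (Q * lam) + ?E) \<le> Q * ((1 + \<theta> n) * ?G + ?e + ?E)"
    using step(2) Q1 by (intro mult_left_mono) auto
  also have "\<dots> = P * ?G + Q * (?e + ?E)" by (simp add: P algebra_simps)
  also have "Q * (?e + ?E) \<le> P * (?e + ?E)"
    using \<open>Q * 1 \<le> P\<close> C_pos t Suc.prems(1,2)
    by (intro mult_right_mono add_nonneg_nonneg sum_nonneg divide_nonneg_pos) (auto simp: less_Suc_eq)
  finally have "g h lam \<le> P * (?G + (\<Sum>k<Suc n. C / (2 ^ k * h * \<theta> k)))"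
    using IH(2) by (simp add: algebra_simps)
  then show ?case using IH(1) by (simp add: mult.assoc)
qed simp

end

section \<open>The second-order coefficient and its growth with the length\<close>

text \<open>In the application \<open>w r\<close> is half the variance of the increment. Uniformity
  over \<open>r \<le> R\<close> matters because the dyadic iteration ends at a base length known
  only to lie in an interval.\<close>

locale almost_additive_cgf_taylor = almost_additive_cgf +
  fixes w :: "real \<Rightarrow> real"
  assumes taylor: "\<And>R e. 0 < e \<Longrightarrow> \<exists>d>0. \<forall>r lam. 0 < r \<and> r \<le> R \<and> lam \<noteq> 0 \<and> \<bar>lam\<bar> \<le> d \<longrightarrow>
      fin r lam \<and> \<bar>f r lam / lam\<^sup>2 - w r\<bar> \<le> e"
begin

lemma eventually_fin:
  assumes "0 < r"
  shows "eventually (\<lambda>lam. fin r lam) (at 0)"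
proof -
  obtain d where "0 < d" "\<And>lam. lam \<noteq> 0 \<Longrightarrow> \<bar>lam\<bar> \<le> d \<Longrightarrow> fin r lam"
    using taylor[of 1 r] assms by (metis order_refl zero_less_one)
  then show ?thesis unfolding eventually_at by (intro exI[of _ d]) auto
qed

lemma tendsto_w:
  assumes "0 < r"
  shows "((\<lambda>lam. f r lam / lam\<^sup>2) \<longlongrightarrow> w r) (at 0)"
proof (rule tendstoI)
  fix e :: real assume "0 < e"
  then obtain d where "0 < d"
    "\<And>lam. lam \<noteq> 0 \<Longrightarrow> \<bar>lam\<bar> \<le> d \<Longrightarrow> \<bar>f r lam / lam\<^sup>2 - w r\<bar> \<le> e / 2"
    using taylor[of "e / 2" r] assms by (metis half_gt_zero order_refl)
  then show "\<forall>\<^sub>F lam in at 0. dist (f r lam / lam\<^sup>2) (w r) < e"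
    unfolding eventually_at using \<open>0 < e\<close> by (intro exI[of _ d]) (fastforce simp: dist_real_def)
qed

lemma filterlim_scale_at_0:
  assumes "\<theta> > (0::real)"
  shows "filterlim (\<lambda>lam. (1 + \<theta>) * lam) (at 0) (at 0)"
proof -
  have "((\<lambda>lam. (1 + \<theta>) * lam) \<longlongrightarrow> (1 + \<theta>) * 0) (at 0)" by (intro tendsto_intros)
  then show ?thesis using assms by (auto simp: filterlim_at eventually_at intro!: exI[of _ 1])
qed

lemma tendsto_w_scaled:
  assumes "0 < r" "0 < \<theta>"
  shows "((\<lambda>lam. f r ((1 + \<theta>) * lam) / (1 + \<theta>) / lam\<^sup>2) \<longlongrightarrow> (1 + \<theta>) * w r) (at 0)"
proof -
  have "((\<lambda>lam. (1 + \<theta>) * (f r ((1 + \<theta>) * lam) / ((1 + \<theta>) * lam)\<^sup>2)) \<longlongrightarrow> (1 + \<theta>) * w r) (at 0)"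
    by (intro tendsto_intros filterlim_compose[OF tendsto_w filterlim_scale_at_0] assms)
  also have "(\<lambda>lam. (1 + \<theta>) * (f r ((1 + \<theta>) * lam) / ((1 + \<theta>) * lam)\<^sup>2)) =
      (\<lambda>lam. f r ((1 + \<theta>) * lam) / (1 + \<theta>) / lam\<^sup>2)"
    using assms by (auto simp: power2_eq_square fun_eq_iff)
  finally show ?thesis .
qed

lemma eventually_fin_scaled:
  assumes "0 < r" "0 < \<theta>"
  shows "eventually (\<lambda>lam. fin r ((1 + \<theta>) * lam)) (at 0)"
  using eventually_compose_filterlim[OF eventually_fin filterlim_scale_at_0] assms by blast

lemma eventually_small:
  "eventually (\<lambda>lam. \<bar>lam\<bar> * (1 + 1 / \<theta>) \<le> c) (at (0::real))"
proof -
  have "((\<lambda>lam::real. \<bar>lam\<bar> * (1 + 1 / \<theta>)) \<longlongrightarrow> \<bar>0\<bar> * (1 + 1 / \<theta>)) (at 0)"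
    by (intro tendsto_intros)
  then have "eventually (\<lambda>lam::real. \<bar>lam\<bar> * (1 + 1 / \<theta>) < c) (at 0)"
    by (rule order_tendstoD(2)) (use c_pos in simp)
  then show ?thesis by (rule eventually_mono) simp
qed

lemma w_nonneg:
  assumes "0 < r"
  shows "0 \<le> w r"
proof (rule tendsto_lowerbound[OF tendsto_w[OF assms]])
  show "\<forall>\<^sub>F lam in at 0. 0 \<le> f r lam / lam\<^sup>2"
    using eventually_fin[OF assms] by (rule eventually_mono) (use nonneg assms in auto)
qed simp

text \<open>For fixed \<open>\<theta>\<close> the smallness and finiteness conditions hold for all
  \<open>lam\<close> near 0, so the bound can be divided by \<open>lam^2\<close> and passed to the
  limit. What remains is valid for every \<open>\<theta> > 0\<close>.\<close>

lemma w_add_le: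
  assumes "0 < a" "0 < b" "0 < \<theta>"
  shows "w (a + b) \<le> (1 + \<theta>) * (w a + w b) + C * (1 + 1 / \<theta>)"
proof -
  have "w (a + b) \<le> (1 + \<theta>) * w a + (1 + \<theta>) * w b + C * (1 + 1 / \<theta>)"
  proof (rule tendsto_le)
    show "((\<lambda>lam. f (a + b) lam / lam\<^sup>2) \<longlongrightarrow> w (a + b)) (at 0)"
      using tendsto_w assms by simp
    show "((\<lambda>lam. f a ((1 + \<theta>) * lam) / (1 + \<theta>) / lam\<^sup>2 + f b ((1 + \<theta>) * lam) / (1 + \<theta>) / lam\<^sup>2
        + C * (1 + 1 / \<theta>)) \<longlongrightarrow> (1 + \<theta>) * w a + (1 + \<theta>) * w b + C * (1 + 1 / \<theta>)) (at 0)"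
      by (intro tendsto_add tendsto_w_scaled tendsto_const assms)
    show "\<forall>\<^sub>F lam in at 0. f (a + b) lam / lam\<^sup>2 \<le> f a ((1 + \<theta>) * lam) / (1 + \<theta>) / lam\<^sup>2 +
        f b ((1 + \<theta>) * lam) / (1 + \<theta>) / lam\<^sup>2 + C * (1 + 1 / \<theta>)"
      using eventually_fin_scaled[OF assms(1,3)] eventually_fin_scaled[OF assms(2,3)]
        eventually_small[of \<theta>] eventually_neq_at_within[of 0]
    proof eventually_elim
      case (elim lam)
      have "f (a + b) lam / lam\<^sup>2 \<le> ((f a ((1 + \<theta>) * lam) + f b ((1 + \<theta>) * lam)) / (1 + \<theta>)
          + C * (1 + 1 / \<theta>) * lam\<^sup>2) / lam\<^sup>2"
        using upper[OF assms(1,2,3) elim(3,1,2)] by (intro divide_right_mono) auto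
      then show ?case using elim(4) by (simp add: add_divide_distrib)
    qed
  qed simp
  then show ?thesis by (simp add: algebra_simps)
qed

lemma w_add_ge:
  assumes "0 < a" "0 < b" "0 < \<theta>"
  shows "w a + w b \<le> (1 + \<theta>) * w (a + b) + C * (1 + 1 / \<theta>)"
proof (rule tendsto_le)
  show "((\<lambda>lam. f a lam / lam\<^sup>2 + f b lam / lam\<^sup>2) \<longlongrightarrow> w a + w b) (at 0)"
    by (intro tendsto_add tendsto_w assms)
  show "((\<lambda>lam. f (a + b) ((1 + \<theta>) * lam) / (1 + \<theta>) / lam\<^sup>2 + C * (1 + 1 / \<theta>)) \<longlongrightarrow>
      (1 + \<theta>) * w (a + b) + C * (1 + 1 / \<theta>)) (at 0)"
    using assms by (intro tendsto_add tendsto_w_scaled tendsto_const) auto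
  have "0 < a + b" using assms by simp
  show "\<forall>\<^sub>F lam in at 0. f a lam / lam\<^sup>2 + f b lam / lam\<^sup>2 \<le>
      f (a + b) ((1 + \<theta>) * lam) / (1 + \<theta>) / lam\<^sup>2 + C * (1 + 1 / \<theta>)"
    using eventually_fin_scaled[OF \<open>0 < a + b\<close> assms(3)]
      eventually_small[of \<theta>] eventually_neq_at_within[of 0]
  proof eventually_elim
    case (elim lam)
    have "(f a lam + f b lam) / lam\<^sup>2 \<le> (f (a + b) ((1 + \<theta>) * lam) / (1 + \<theta>)
        + C * (1 + 1 / \<theta>) * lam\<^sup>2) / lam\<^sup>2"
      using lower[OF assms(1,2,3) elim(2,1)] by (intro divide_right_mono) auto
    then show ?case using elim(3) by (simp add: add_divide_distrib)
  qed
qed simp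

text \<open>Optimising over \<open>\<theta>\<close> recovers the triangle inequality for standard
  deviations, with an error of norm at most \<open>sqrt C\<close>.\<close>

lemma sqrt_w_add:
  assumes "0 < a" "0 < b"
  shows "\<bar>sqrt (w (a + b)) - sqrt (w a + w b)\<bar> \<le> sqrt C"
proof -
  have "sqrt (w (a + b)) \<le> sqrt (w a + w b) + sqrt C"
    by (intro sqrt_le_add_sqrt w_add_le) (use w_nonneg assms C_pos in auto)
  moreover have "sqrt (w a + w b) \<le> sqrt (w (a + b)) + sqrt C"
    by (intro sqrt_le_add_sqrt w_add_ge) (use w_nonneg assms C_pos in auto)
  ultimately show ?thesis by linarith
qed

text \<open>A stability argument for additive functions: rescaling along \<open>2 ^ n * a\<close>
  shrinks the defect of additivity by \<open>sqrt (1 / 2)\<close> per doubling. The square of the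
  limit is exactly additive, hence linear, and the distance to the limit is bounded by a geometric
  series.\<close>

lemma sqrt_w_limit:
  "\<exists>L\<ge>0. \<forall>a>0. \<bar>sqrt (w a) - sqrt (L * a)\<bar> \<le> sqrt C / (1 - sqrt (1 / 2))"
proof -
  define z where "z a n = sqrt (w (2 ^ n * a) / 2 ^ n)" for a :: real and n :: nat
  define W where "W a = lim (z a)" for a
  let ?\<rho> = "sqrt (1 / 2) :: real"
  have \<rho>: "0 \<le> ?\<rho>" "?\<rho> < 1" by (auto intro: real_less_lsqrt)
  have pow: "1 / sqrt (2 ^ n) = ?\<rho> ^ n" for n :: nat
    by (simp add: real_sqrt_power real_sqrt_divide power_divide)
  have scaled: "\<bar>sqrt (w (2 ^ n * (a + b)) / 2 ^ n) - sqrt (w (2 ^ n * a) / 2 ^ n + w (2 ^ n * b) / 2 ^ n)\<bar>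
      \<le> sqrt C * ?\<rho> ^ n" if "0 < a" "0 < b" for a b n
  proof -
    have "\<bar>sqrt (w (2 ^ n * (a + b)) / 2 ^ n) - sqrt (w (2 ^ n * a) / 2 ^ n + w (2 ^ n * b) / 2 ^ n)\<bar>
      = \<bar>sqrt (w (2 ^ n * a + 2 ^ n * b)) - sqrt (w (2 ^ n * a) + w (2 ^ n * b))\<bar> / sqrt (2 ^ n)"
      by (simp add: real_sqrt_divide distrib_left add_divide_distrib[symmetric]
          diff_divide_distrib[symmetric])
    also have "\<dots> \<le> sqrt C / sqrt (2 ^ n)"
      by (intro divide_right_mono sqrt_w_add) (use that in auto)
    also have "\<dots> = sqrt C * (1 / sqrt (2 ^ n))" by simp
    finally show ?thesis by (simp only: pow)
  qed
  have step: "\<bar>z a (Suc n) - z a n\<bar> \<le> sqrt C * ?\<rho> ^ n" if "0 < a" for a n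
  proof -
    \<comment> \<open>For equal summands both square roots in \<open>scaled\<close> contain the
      factor \<open>sqrt 2\<close>, which is at least 1 and is dropped afterwards.\<close>
    have "\<bar>z a (Suc n) - z a n\<bar> * sqrt 2 \<le> sqrt C * ?\<rho> ^ n"
    proof -
      have "w (2 ^ n * (a + a)) / 2 ^ n = 2 * (w (2 ^ Suc n * a) / 2 ^ Suc n)"
        by (simp add: mult_2[symmetric] algebra_simps)
      then have "sqrt (w (2 ^ n * (a + a)) / 2 ^ n) = sqrt 2 * z a (Suc n)"
        by (simp only: z_def real_sqrt_mult)
      moreover have "sqrt (w (2 ^ n * a) / 2 ^ n + w (2 ^ n * a) / 2 ^ n) = sqrt 2 * z a n"
        unfolding z_def real_sqrt_mult[symmetric] by simp
      ultimately have "\<bar>sqrt 2 * z a (Suc n) - sqrt 2 * z a n\<bar> \<le> sqrt C * ?\<rho> ^ n"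
        using scaled[OF that that, of n] by simp
      then show ?thesis
        by (simp only: right_diff_distrib[symmetric] abs_mult) (simp add: mult.commute)
    qed
    moreover have "\<bar>z a (Suc n) - z a n\<bar> * 1 \<le> \<bar>z a (Suc n) - z a n\<bar> * sqrt 2"
      by (rule mult_left_mono) auto
    ultimately show ?thesis unfolding mult_1_right by (rule order_trans[rotated])
  qed
  have z_0: "z a 0 = sqrt (w a)" for a by (simp add: z_def)
  have conv: "z a \<longlonglongrightarrow> W a" "\<bar>W a - sqrt (w a)\<bar> \<le> sqrt C / (1 - ?\<rho>)" if "0 < a" for a
    using geometric_steps_convergent[OF step[OF that] \<rho>]
    by (simp_all add: W_def convergent_LIMSEQ_iff z_0)
  have W_nonneg: "0 \<le> W a" if "0 < a" for a
    by (rule tendsto_lowerbound[OF conv(1)[OF that]])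
      (use that w_nonneg in \<open>auto simp: z_def intro!: always_eventually\<close>)
  have W_add: "(W (a + b))\<^sup>2 = (W a)\<^sup>2 + (W b)\<^sup>2" if "0 < a" "0 < b" for a b
  proof -
    \<comment> \<open>One sequence with two limits: by \<open>conv\<close> the defect of
      \<open>W\<close>, by \<open>scaled\<close> zero.\<close>
    have "(\<lambda>n. z (a + b) n - sqrt ((z a n)\<^sup>2 + (z b n)\<^sup>2)) \<longlonglongrightarrow> W (a + b) - sqrt ((W a)\<^sup>2 + (W b)\<^sup>2)"
      using that by (intro tendsto_intros conv) auto
    moreover have "(\<lambda>n. z (a + b) n - sqrt ((z a n)\<^sup>2 + (z b n)\<^sup>2)) \<longlonglongrightarrow> 0"
    proof (rule Lim_null_comparison)
      have "(z a n)\<^sup>2 = w (2 ^ n * a) / 2 ^ n" "(z b n)\<^sup>2 = w (2 ^ n * b) / 2 ^ n" for n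
        using w_nonneg that by (simp_all add: z_def)
      then show "\<forall>\<^sub>F n in sequentially. norm (z (a + b) n - sqrt ((z a n)\<^sup>2 + (z b n)\<^sup>2)) \<le> sqrt C * ?\<rho> ^ n"
        using scaled[OF that] by (intro always_eventually) (simp add: z_def)
      show "(\<lambda>n. sqrt C * ?\<rho> ^ n) \<longlonglongrightarrow> 0"
        using \<rho> by (intro tendsto_mult_right_zero LIMSEQ_power_zero) auto
    qed
    ultimately have "W (a + b) - sqrt ((W a)\<^sup>2 + (W b)\<^sup>2) = 0" by (rule LIMSEQ_unique)
    then show ?thesis by simp
  qed
  have lin: "(W a)\<^sup>2 = a * (W 1)\<^sup>2" if "0 < a" for a
    by (rule nonneg_additive_linear[of "\<lambda>a. (W a)\<^sup>2"]) (use that W_add in auto)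
  have "\<bar>sqrt (w a) - sqrt ((W 1)\<^sup>2 * a)\<bar> \<le> sqrt C / (1 - ?\<rho>)" if "0 < a" for a
  proof -
    have "sqrt ((W 1)\<^sup>2 * a) = W a"
      using real_sqrt_unique[OF lin[OF that] W_nonneg[OF that]] by (simp only: mult.commute)
    then show ?thesis using conv(2)[OF that] by (simp only: abs_minus_commute)
  qed
  then show ?thesis by (intro exI[of _ "(W 1)\<^sup>2"] conjI allI impI) auto
qed

text \<open>The bound on the difference of square roots is independent of the length, so division by
  \<open>sqrt a\<close> makes it vanish in the limit.\<close>

lemma w_limit:
  obtains L where "0 \<le> L" "((\<lambda>a. w a / a) \<longlongrightarrow> L) at_top"
proof -
  obtain L where "0 \<le> L"
    and L: "\<And>a. 0 < a \<Longrightarrow> \<bar>sqrt (w a) - sqrt (L * a)\<bar> \<le> sqrt C / (1 - sqrt (1 / 2))"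
    using sqrt_w_limit by blast
  define B where "B = sqrt C / (1 - sqrt (1 / 2))"
  have "((\<lambda>a. sqrt (w a / a) - sqrt L) \<longlongrightarrow> 0) at_top"
  proof (rule Lim_null_comparison)
    show "\<forall>\<^sub>F a in at_top. norm (sqrt (w a / a) - sqrt L) \<le> B / sqrt a"
      using eventually_gt_at_top[of 0]
    proof eventually_elim
      case (elim a)
      have "sqrt (w a / a) - sqrt L = (sqrt (w a) - sqrt (L * a)) / sqrt a"
        using elim by (simp add: real_sqrt_divide real_sqrt_mult field_simps)
      moreover have "\<bar>sqrt (w a) - sqrt (L * a)\<bar> / sqrt a \<le> B / sqrt a"
        using L[OF elim] elim by (intro divide_right_mono) (simp_all add: B_def)
      ultimately show ?case using elim by simp
    qed
    show "((\<lambda>a. B / sqrt a) \<longlongrightarrow> 0) at_top"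
      by (intro tendsto_divide_0[OF tendsto_const] filterlim_at_top_imp_at_infinity sqrt_at_top)
  qed
  then have "((\<lambda>a. (sqrt (w a / a) - sqrt L + sqrt L)\<^sup>2) \<longlongrightarrow> (0 + sqrt L)\<^sup>2) at_top"
    by (intro tendsto_intros)
  then have "((\<lambda>a. (sqrt (w a / a))\<^sup>2) \<longlongrightarrow> L) at_top" using \<open>0 \<le> L\<close> by simp
  moreover have "\<forall>\<^sub>F a in at_top. (sqrt (w a / a))\<^sup>2 = w a / a"
    using eventually_gt_at_top[of 0] by eventually_elim (use w_nonneg in auto)
  ultimately have "((\<lambda>a. w a / a) \<longlongrightarrow> L) at_top" by (rule Lim_transform_eventually)
  with \<open>0 \<le> L\<close> show ?thesis by (rule that)
qed

end

section \<open>Auxiliary estimates for the dyadic scales\<close>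

lemma prod_one_plus_le_exp_sum:
  fixes \<theta> :: "nat \<Rightarrow> real"
  assumes "\<And>k. k < n \<Longrightarrow> 0 \<le> \<theta> k"
  shows "(\<Prod>k<n. 1 + \<theta> k) \<le> exp (\<Sum>k<n. \<theta> k)"
  unfolding exp_sum[OF finite_lessThan] using assms by (intro prod_mono) auto

lemma geometric_partial_sum_le:
  fixes x :: real
  assumes "0 \<le> x" "x < 1"
  shows "(\<Sum>k<n. x ^ k) \<le> 1 / (1 - x)"
  using assms by (auto simp: sum_gp_strict intro!: divide_right_mono)

text \<open>\<open>n\<close> is the largest exponent with \<open>2 ^ n * H \<le> r\<close>, the
  predecessor of the least exponent that overshoots; \<open>H \<le> r\<close> ensures that the
  latter is not 0.\<close>

lemma dyadic_decomposition:
  fixes H r :: real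
  assumes "0 < H" "H \<le> r"
  obtains n :: nat and h where "r = 2 ^ n * h" "H \<le> h" "h \<le> 2 * H"
proof -
  define m where "m = (LEAST m. r < 2 ^ m * H)"
  obtain k :: nat where "r / H < 2 ^ k" using real_arch_pow[of 2] by auto
  then have "r < 2 ^ k * H" using \<open>0 < H\<close> by (simp add: pos_divide_less_eq)
  then have m: "r < 2 ^ m * H" unfolding m_def by (rule LeastI)
  with assms have "m \<noteq> 0" by (intro notI) simp
  then obtain n where n: "m = Suc n" by (cases m) auto
  have "\<not> r < 2 ^ n * H" using not_less_Least[of n "\<lambda>m. r < 2 ^ m * H"] n m_def by simp
  with m n show ?thesis
    by (intro that[of n "r / 2 ^ n"]) (simp_all add: field_simps)
qed

text \<open>The error budget of the convergence proof: \<open>G\<close> is the quotient at the full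
  length, \<open>A\<close> and \<open>B\<close> are quotients at the base length, \<open>E\<close>
  is the accumulated additive error and \<open>P\<close> the product of the factors
  \<open>1 + \<theta> k\<close>.\<close>

lemma abs_diff_le_of_two_sided_bounds:
  fixes G L A B E P e \<epsilon> :: real
  assumes "0 < \<epsilon>" "0 \<le> L" "1 \<le> P" "P \<le> 1 + e" "e \<le> 1" "e * (L + 1) \<le> \<epsilon> / 2"
    and "G \<le> P * (A + E)" "B \<le> P * (G + E)" "A \<le> L + \<epsilon> / 6" "L - \<epsilon> / 6 \<le> B" "E \<le> \<epsilon> / 12"
  shows "\<bar>G - L\<bar> \<le> \<epsilon>"
proof -
  have "0 \<le> e" using assms by linarith
  have eL: "e * L \<le> \<epsilon> / 2 - e" using assms(6) by (simp add: algebra_simps)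
  have "P * (A + E) \<le> P * (L + \<epsilon> / 4)" using assms by (intro mult_left_mono) auto
  also have "\<dots> \<le> (1 + e) * (L + \<epsilon> / 4)" using assms by (intro mult_right_mono) auto
  also have "\<dots> = L + \<epsilon> / 4 + e * L + e * (\<epsilon> / 4)" by (simp add: algebra_simps)
  also have "e * (\<epsilon> / 4) \<le> 1 * (\<epsilon> / 4)" using assms by (intro mult_right_mono) auto
  finally have "G \<le> L + \<epsilon>" using assms(7) eL \<open>0 \<le> e\<close> by simp
  moreover have "L - \<epsilon> \<le> G"
  \<comment> \<open>The contrary gives \<open>G + E \<le> L\<close>, which limits what
    multiplication by \<open>P\<close> can add. The sign matters: a negative \<open>G + E\<close>
    only decreases.\<close>
  proof (rule ccontr)
    assume "\<not> L - \<epsilon> \<le> G"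
    then have "G + E \<le> L" using assms by linarith
    have "P * (G + E) \<le> G + E + e * L"
    proof (cases "0 \<le> G + E")
      case True
      have "P * (G + E) \<le> (1 + e) * (G + E)" using assms True by (intro mult_right_mono) auto
      moreover have "e * (G + E) \<le> e * L" using \<open>G + E \<le> L\<close> \<open>0 \<le> e\<close> by (rule mult_left_mono)
      ultimately show ?thesis by (simp add: algebra_simps)
    next
      case False
      then have "P * (G + E) \<le> 1 * (G + E)" using assms by (intro mult_right_mono_neg) auto
      moreover have "0 \<le> e * L" using \<open>0 \<le> e\<close> \<open>0 \<le> L\<close> by simp
      ultimately show ?thesis by simp
    qed
    then show False using assms eL \<open>0 \<le> e\<close> \<open>\<not> L - \<epsilon> \<le> G\<close> by linarith
  qed
  ultimately show ?thesis by linarith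
qed

section \<open>Convergence of the normalised quotient\<close>

context almost_additive_cgf_taylor
begin

text \<open>
  Passing from length \<open>2\<^sup>k h\<close> to \<open>2\<^sup>k\<^sup>+\<^sup>1 h\<close> costs a relative error \<open>\<theta> k\<close> and an absolute error
  \<open>C / (2\<^sup>k h \<theta> k)\<close>, and requires \<open>\<theta> k\<close> to dominate \<open>\<bar>lam\<bar>\<close>. With \<open>\<theta> k = \<eta> (3/4)\<^sup>k + K \<bar>lam\<bar>\<close> both
  errors are summable over \<open>k < n\<close>, apart from the contribution \<open>n K \<bar>lam\<bar>\<close>.
\<close>

lemma g_limit:
  "\<exists>L. \<forall>\<epsilon>>0. \<exists>R>0. \<exists>\<delta>>0. \<forall>r\<ge>R. \<forall>lam. lam \<noteq> 0 \<and> \<bar>lam\<bar> * ln r \<le> \<delta> \<longrightarrow>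
     fin r lam \<and> \<bar>g r lam - L\<bar> \<le> \<epsilon>"
proof -
  obtain L where "0 \<le> L" and L: "((\<lambda>a. w a / a) \<longlongrightarrow> L) at_top" by (rule w_limit)
  have "\<exists>R>0. \<exists>\<delta>>0. \<forall>r\<ge>R. \<forall>lam. lam \<noteq> 0 \<and> \<bar>lam\<bar> * ln r \<le> \<delta> \<longrightarrow>
     fin r lam \<and> \<bar>g r lam - L\<bar> \<le> \<epsilon>" if "0 < \<epsilon>" for \<epsilon>
  proof -
    \<comment> \<open>\<open>e\<close> is the allowance for \<open>P - 1\<close>. Below,
      \<open>q\<close> is the corresponding allowance for the sum of the \<open>\<theta> k\<close>,
      because \<open>P\<close> is at most the exponential of that sum.\<close>
    define e where "e = min 1 (\<epsilon> / (2 * (L + 1)))"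
    have e: "0 < e" "e \<le> 1" using \<open>0 < \<epsilon>\<close> \<open>0 \<le> L\<close> by (auto simp: e_def)
    have "e \<le> (\<epsilon> / 2) / (L + 1)" by (simp add: e_def)
    then have eL: "e * (L + 1) \<le> \<epsilon> / 2" using \<open>0 \<le> L\<close> by (subst (asm) pos_le_divide_eq) auto
    define q where "q = ln (1 + e)"
    have q: "0 < q" "exp q = 1 + e" using e by (auto simp: q_def)
    have "\<forall>\<^sub>F a in at_top. dist (w a / a) L < \<epsilon> / 12" using \<open>0 < \<epsilon>\<close> by (intro tendstoD[OF L]) simp
    then obtain H0 where H0: "\<And>a. H0 \<le> a \<Longrightarrow> \<bar>w a / a - L\<bar> \<le> \<epsilon> / 12"
      unfolding eventually_at_top_linorder by (auto simp: dist_real_def intro: less_imp_le)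
    \<comment> \<open>The entries give in turn \<open>\<eta> \<le> 1 / 2\<close>,
      \<open>4 * \<eta> \<le> q / 2\<close>, a total additive error of at most
      \<open>\<epsilon> / 12\<close>, and closeness of \<open>w a / a\<close> to
      \<open>L\<close>.\<close>
    define S where "S = Max {2, 8 / q, 36 * C / \<epsilon>, H0}"
    have S: "2 \<le> S" "8 / q \<le> S" "36 * C / \<epsilon> \<le> S" "H0 \<le> S" by (simp_all add: S_def)
    \<comment> \<open>Here \<open>\<eta>\<close> is small while \<open>H * \<eta> = S\<close> is
      large, so the relative errors, of sum at most \<open>4 * \<eta>\<close>, and the additive
      ones, of sum at most \<open>3 * C / (H * \<eta>)\<close>, are small together. \<open>K\<close>
      makes \<open>c * \<theta> k\<close> at least \<open>6 * \<bar>lam\<bar>\<close>, enough for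
      the smallness condition once \<open>P \<le> 2\<close>.\<close>
    define H \<eta> K where "H = S\<^sup>2" and "\<eta> = 1 / S" and "K = 6 / c"
    have "S * 1 \<le> S * S" using S by (intro mult_left_mono) auto
    then have "S \<le> H" unfolding H_def power2_eq_square by (simp only: mult_1_right)
    with S have H: "S \<le> H" "2 \<le> H" by linarith+
    have \<eta>: "0 < \<eta>" "\<eta> \<le> 1 / 2" "4 * \<eta> \<le> q / 2" "3 * C / (H * \<eta>) \<le> \<epsilon> / 12"
    proof -
      show "0 < \<eta>" "\<eta> \<le> 1 / 2" using S by (auto simp: \<eta>_def field_simps)
      show "4 * \<eta> \<le> q / 2" using S q by (simp add: \<eta>_def field_simps)
      have "H * \<eta> = S" using S by (simp add: H_def \<eta>_def power2_eq_square)
      then show "3 * C / (H * \<eta>) \<le> \<epsilon> / 12" using S \<open>0 < \<epsilon>\<close> by (simp add: field_simps)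
    qed
    have K: "0 < K" "c * K = 6" using c_pos by (auto simp: K_def)
    obtain d where "0 < d" and d: "\<And>r lam. 0 < r \<Longrightarrow> r \<le> 2 * H \<Longrightarrow> lam \<noteq> 0 \<Longrightarrow> \<bar>lam\<bar> \<le> d \<Longrightarrow>
        fin r lam \<and> \<bar>f r lam / lam\<^sup>2 - w r\<bar> \<le> \<epsilon> / 12"
      using taylor[of "\<epsilon> / 12" "2 * H"] \<open>0 < \<epsilon>\<close> by auto
    \<comment> \<open>As \<open>h \<ge> 1\<close>, division by \<open>h\<close> does not enlarge the
      Taylor error; the other half of \<open>\<epsilon> / 6\<close> is the distance of
      \<open>w h / h\<close> from \<open>L\<close>.\<close>
    have g_near: "\<bar>g h \<mu> - L\<bar> \<le> \<epsilon> / 6" if "H \<le> h" "h \<le> 2 * H" "\<mu> \<noteq> 0" "\<bar>\<mu>\<bar> \<le> d" for h \<mu>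
    proof -
      have h: "1 \<le> h" "H0 \<le> h" using that H S by linarith+
      have "g h \<mu> - w h / h = (f h \<mu> / \<mu>\<^sup>2 - w h) / h"
        using h by (simp add: g_def diff_divide_distrib mult.commute)
      also have "\<bar>\<dots>\<bar> \<le> \<epsilon> / 12 / 1"
        unfolding abs_divide using d[of h \<mu>] h that \<open>0 < \<epsilon>\<close> by (intro frac_le) auto
      finally show ?thesis using H0[OF h(2)] by linarith
    qed
    \<comment> \<open>\<open>d / 2\<close> keeps \<open>P * lam\<close> in the Taylor range when
      \<open>P \<le> 2\<close>; \<open>q / (4 * K)\<close> bounds the contribution of
      \<open>K * \<bar>lam\<bar>\<close> over all scales by \<open>q / 2\<close>;
      \<open>1 / (2 * K)\<close> helps to keep \<open>\<theta> k \<le> 1\<close>.\<close>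
    define \<delta> where "\<delta> = Min {d / 2, q / (4 * K), 1 / (2 * K)}"
    have "0 < \<delta>" using \<open>0 < d\<close> q K by (simp add: \<delta>_def)
    have "\<delta> \<le> d / 2" "\<delta> \<le> q / (4 * K)" "\<delta> \<le> 1 / (2 * K)"
      unfolding \<delta>_def by (rule Min_le; simp)+
    then have \<delta>: "2 * \<delta> \<le> d" "K * \<delta> \<le> q / 4" "K * \<delta> \<le> 1 / 2"
      using K(1) by (simp_all add: field_simps)
    have main: "fin r lam \<and> \<bar>g r lam - L\<bar> \<le> \<epsilon>"
      if r: "max H 3 \<le> r" and "lam \<noteq> 0" and lam: "\<bar>lam\<bar> * ln r \<le> \<delta>" for r lam
    proof -
      \<comment> \<open>With \<open>ln r \<ge> 1\<close> the condition on
        \<open>\<bar>lam\<bar> * ln r\<close> also bounds \<open>\<bar>lam\<bar>\<close>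
        itself.\<close>
      have "exp 1 \<le> r" using r exp_le by linarith
      then have "1 \<le> ln r" using r by (simp add: ln_ge_iff)
      then have "\<bar>lam\<bar> * 1 \<le> \<bar>lam\<bar> * ln r" by (intro mult_left_mono) auto
      then have l: "\<bar>lam\<bar> \<le> \<delta>" using lam by linarith
      then have Kl: "K * \<bar>lam\<bar> \<le> K * \<delta>" using K by (intro mult_left_mono) auto
      obtain n h where rh: "r = 2 ^ n * h" "H \<le> h" "h \<le> 2 * H"
        using dyadic_decomposition[of H r] H r by auto
      have "0 < h" using rh H by linarith
      \<comment> \<open>The number of scales is at most \<open>2 * ln r\<close>, since
        \<open>h \<ge> 1\<close> and \<open>ln 2 \<ge> 1 / 2\<close>.\<close>
      have "2 ^ n * 1 \<le> r" unfolding rh(1) using rh(2) H by (intro mult_left_mono) auto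
      then have "ln (2 ^ n) \<le> ln r" using r by (subst ln_le_cancel_iff) auto
      then have "real n * ln 2 \<le> ln r" by (simp add: ln_realpow)
      moreover have "real n * (1 / 2) \<le> real n * ln 2"
        using ln2_ge_two_thirds by (intro mult_left_mono) auto
      ultimately have n: "real n \<le> 2 * ln r" by linarith
      define \<theta> where "\<theta> k = \<eta> * (3 / 4) ^ k + K * \<bar>lam\<bar>" for k :: nat
      have \<theta>_ge: "K * \<bar>lam\<bar> \<le> \<theta> k" "\<eta> * (3 / 4) ^ k \<le> \<theta> k" "0 < \<eta> * (3 / 4) ^ k" for k
        using \<eta> K by (auto simp: \<theta>_def)
      have \<theta>_pos: "0 < \<theta> k" for k using \<theta>_ge[of k] by linarith
      have \<theta>_le: "\<theta> k \<le> 1" for k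
      proof -
        have "\<eta> * (3 / 4) ^ k \<le> \<eta> * 1" using \<eta> by (intro mult_left_mono power_le_one) auto
        then show ?thesis using \<eta>(2) Kl \<delta>(3) unfolding \<theta>_def by linarith
      qed
      define P where "P = (\<Prod>k<n. 1 + \<theta> k)"
      have P1: "1 \<le> P" unfolding P_def using \<theta>_pos by (intro prod_ge_1) (auto simp: less_imp_le)
      have "(\<Sum>k<n. \<theta> k) = \<eta> * (\<Sum>k<n. (3 / 4) ^ k) + real n * (K * \<bar>lam\<bar>)"
        by (simp add: \<theta>_def sum.distrib sum_distrib_left)
      also have "\<eta> * (\<Sum>k<n. (3 / 4) ^ k) \<le> \<eta> * 4"
        using geometric_partial_sum_le[of "3 / 4" n] \<eta> by (intro mult_left_mono) auto
      also have "real n * (K * \<bar>lam\<bar>) \<le> 2 * ln r * (K * \<bar>lam\<bar>)"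
        using n K by (intro mult_right_mono) auto
      also have "2 * ln r * (K * \<bar>lam\<bar>) = 2 * K * (\<bar>lam\<bar> * ln r)" by simp
      also have "\<dots> \<le> 2 * K * \<delta>" using lam K by (intro mult_left_mono) auto
      finally have "(\<Sum>k<n. \<theta> k) \<le> q" using \<eta>(3) \<delta>(2) by linarith
      then have "P \<le> exp q"
        unfolding P_def using prod_one_plus_le_exp_sum[of n \<theta>] \<theta>_pos
        by (meson exp_le_cancel_iff less_imp_le order_trans)
      then have P2: "P \<le> 1 + e" "P \<le> 2" using q e by auto
      define E where "E = (\<Sum>k<n. C / (2 ^ k * h * \<theta> k))"
      \<comment> \<open>From one scale to the next the length doubles while the geometric part of
        \<open>\<theta> k\<close> loses a quarter, so the denominators grow at least like
        \<open>(3 / 2) ^ k\<close> and the errors are summable.\<close>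
      have "E \<le> (\<Sum>k<n. C / (H * \<eta>) * (2 / 3) ^ k)"
        unfolding E_def
      proof (rule sum_mono)
        fix k
        have "2 ^ k * H * (\<eta> * (3 / 4) ^ k) \<le> 2 ^ k * h * \<theta> k"
          using rh(2) \<theta>_ge[of k] H by (intro mult_mono) auto
        then have "C / (2 ^ k * h * \<theta> k) \<le> C / (2 ^ k * H * (\<eta> * (3 / 4) ^ k))"
          using C_pos \<eta> H by (intro divide_left_mono mult_pos_pos \<theta>_pos \<open>0 < h\<close>) auto
        also have "2 ^ k * H * (\<eta> * (3 / 4) ^ k) = H * \<eta> * (3 / 2) ^ k"
        proof -
          have "(3 / 2 :: real) ^ k = 2 ^ k * (3 / 4) ^ k" unfolding power_mult_distrib[symmetric] by simp
          then show ?thesis by (simp only: mult_ac)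
        qed
        also have "C / (H * \<eta> * (3 / 2) ^ k) = C / (H * \<eta>) * (2 / 3) ^ k"
          by (simp add: power_divide)
        finally show "C / (2 ^ k * h * \<theta> k) \<le> C / (H * \<eta>) * (2 / 3) ^ k" .
      qed
      also have "\<dots> = C / (H * \<eta>) * (\<Sum>k<n. (2 / 3) ^ k)" by (simp add: sum_distrib_left)
      also have "\<dots> \<le> C / (H * \<eta>) * 3"
        using geometric_partial_sum_le[of "2 / 3" n] C_pos H \<eta> by (intro mult_left_mono) auto
      finally have E: "E \<le> \<epsilon> / 12" using \<eta>(4) by simp
      have "\<bar>lam\<bar> * P \<le> \<bar>lam\<bar> * 2" using P2 by (intro mult_left_mono) auto
      then have lP: "\<bar>P * lam\<bar> \<le> d" "2 * (\<bar>lam\<bar> * P) \<le> 6 * \<bar>lam\<bar>"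
        using P1 l \<delta> by (auto simp: abs_mult mult.commute)
      have c\<theta>: "6 * \<bar>lam\<bar> \<le> c * \<theta> k" for k
        using mult_left_mono[OF \<theta>_ge(1)[of k], of c] c_pos K by (simp flip: mult.assoc)
      have fin_h: "fin h (P * lam)" using d[of h "P * lam"] rh \<open>0 < h\<close> lP P1 \<open>lam \<noteq> 0\<close> by auto
      have up: "fin r lam" "g r lam \<le> P * (g h (P * lam) + E)"
        using g_pow2_le[OF \<open>0 < h\<close>, of n \<theta> lam P] \<theta>_pos \<theta>_le \<open>lam \<noteq> 0\<close> lP(2) c\<theta> fin_h
        unfolding P_def[symmetric] E_def[symmetric] rh(1)[symmetric] by (meson order_trans)+
      \<comment> \<open>Started at \<open>lam / P\<close>, the reverse bound ends at
        \<open>lam\<close>; the finiteness it needs at length \<open>r\<close> is supplied by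
        \<open>up\<close>.\<close>
      have lP': "lam / P \<noteq> 0" "P * (lam / P) = lam" "\<bar>lam / P\<bar> * P = \<bar>lam\<bar>" "\<bar>lam / P\<bar> \<le> \<bar>lam\<bar>"
        using P1 \<open>lam \<noteq> 0\<close> by (auto simp: field_simps abs_divide)
      have "2 * (\<bar>lam / P\<bar> * P) \<le> c * \<theta> k" for k unfolding lP'(3) using c\<theta>[of k] by linarith
      then have low: "g h (lam / P) \<le> P * (g r lam + E)"
        using g_le_pow2[OF \<open>0 < h\<close>, of n \<theta> "lam / P" P] \<theta>_pos \<theta>_le lP'(1) up(1)
        unfolding P_def[symmetric] E_def[symmetric] rh(1)[symmetric] lP'(2) by blast
      have "\<bar>g h (P * lam) - L\<bar> \<le> \<epsilon> / 6" "\<bar>g h (lam / P) - L\<bar> \<le> \<epsilon> / 6"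
        using rh lP(1) P1 \<open>lam \<noteq> 0\<close> lP' l \<delta> \<open>0 < \<delta>\<close> by (intro g_near; simp)+
      then have "g h (P * lam) \<le> L + \<epsilon> / 6" "L - \<epsilon> / 6 \<le> g h (lam / P)" by linarith+
      then have "\<bar>g r lam - L\<bar> \<le> \<epsilon>"
        by (intro abs_diff_le_of_two_sided_bounds[OF \<open>0 < \<epsilon>\<close> \<open>0 \<le> L\<close> P1 P2(1) e(2) eL up(2) low _ _ E])
      with up(1) show ?thesis ..
    qed
    show ?thesis
      by (rule exI[of _ "max H 3"]) (use main \<open>0 < \<delta>\<close> in auto)
  qed
  then show ?thesis by blast
qed

end

section \<open>Exponential moments\<close>

lemma real_power_le_exp:
  fixes x :: real
  assumes "0 \<le> x"
  shows "x ^ n / fact n \<le> exp x"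
proof -
  have sums: "(\<lambda>k. x ^ k / fact k) sums exp x"
    using exp_converges[of x] by (simp add: divide_inverse mult.commute)
  have "(\<Sum>k\<in>{n}. x ^ k / fact k) \<le> (\<Sum>k. x ^ k / fact k)"
    by (rule sum_le_suminf[OF sums_summable[OF sums]]) (use assms in auto)
  then show ?thesis using sums_unique[OF sums] by simp
qed

text \<open>Lagrange's remainder: the intermediate point is at most \<open>\<bar>x\<bar>\<close> in
  modulus, and the constants \<open>1 / 2\<close> and \<open>1 / 6\<close> are given away.\<close>

lemma exp_quadratic_bound:
  fixes x :: real
  shows "\<bar>exp x - 1 - x\<bar> \<le> x\<^sup>2 * exp \<bar>x\<bar>"
    and "\<bar>exp x - 1 - x - x\<^sup>2 / 2\<bar> \<le> \<bar>x\<bar> ^ 3 * exp \<bar>x\<bar>"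
proof -
  obtain t where t: "\<bar>t\<bar> \<le> \<bar>x\<bar>" "exp x = (\<Sum>m<2. x ^ m / fact m) + exp t / fact 2 * x ^ 2"
    using Maclaurin_exp_le by blast
  have "exp t \<le> exp \<bar>x\<bar>" using t(1) by simp
  moreover have "0 < exp t" by simp
  ultimately have "exp t / 2 \<le> exp \<bar>x\<bar>" by linarith
  then have "exp t / 2 * x\<^sup>2 \<le> exp \<bar>x\<bar> * x\<^sup>2" by (rule mult_right_mono) simp
  then show "\<bar>exp x - 1 - x\<bar> \<le> x\<^sup>2 * exp \<bar>x\<bar>"
    using t(2) by (simp add: numeral_2_eq_2 mult.commute)
  obtain s where s: "\<bar>s\<bar> \<le> \<bar>x\<bar>" "exp x = (\<Sum>m<3. x ^ m / fact m) + exp s / fact 3 * x ^ 3"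
    using Maclaurin_exp_le by blast
  have "exp s \<le> exp \<bar>x\<bar>" using s(1) by simp
  moreover have "0 < exp s" by simp
  ultimately have "exp s / 6 \<le> exp \<bar>x\<bar>" by linarith
  then have "exp s / 6 * \<bar>x\<bar> ^ 3 \<le> exp \<bar>x\<bar> * \<bar>x\<bar> ^ 3" by (rule mult_right_mono) simp
  moreover have e: "exp x - 1 - x - x\<^sup>2 / 2 = exp s / 6 * x ^ 3"
    using s(2) by (simp add: eval_nat_numeral)
  ultimately show "\<bar>exp x - 1 - x - x\<^sup>2 / 2\<bar> \<le> \<bar>x\<bar> ^ 3 * exp \<bar>x\<bar>"
    unfolding e abs_mult power_abs by (simp add: mult.commute)
qed

section \<open>Cumulant generating functions of single random variables\<close>

context prob_space
begin

abbreviation cgf :: "('a \<Rightarrow> real) \<Rightarrow> real \<Rightarrow> real" where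
  "cgf Y t \<equiv> ln (expectation (\<lambda>x. exp (t * Y x)))"

lemma integrable_exp_between:
  fixes Y :: "'a \<Rightarrow> real"
  assumes [measurable]: "Y \<in> borel_measurable M"
    and "integrable M (\<lambda>x. exp (- s * Y x))" "integrable M (\<lambda>x. exp (s * Y x))" "\<bar>t\<bar> \<le> s"
  shows "integrable M (\<lambda>x. exp (t * Y x))" "integrable M (\<lambda>x. exp (t * \<bar>Y x\<bar>))"
proof -
  have *: "exp (t * \<bar>y\<bar>) \<le> exp (- s * y) + exp (s * y)" "exp (t * y) \<le> exp (- s * y) + exp (s * y)"
    for y
  proof -
    have "\<bar>t * \<bar>y\<bar>\<bar> \<le> s * \<bar>y\<bar>" "\<bar>t * y\<bar> \<le> s * \<bar>y\<bar>"
      using assms by (auto simp: abs_mult intro: mult_right_mono)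
    then have "exp (t * \<bar>y\<bar>) \<le> exp (s * \<bar>y\<bar>)" "exp (t * y) \<le> exp (s * \<bar>y\<bar>)" by auto
    moreover have "exp (s * \<bar>y\<bar>) \<le> exp (- s * y) + exp (s * y)"
      by (cases "0 \<le> y") auto
    ultimately show "exp (t * \<bar>y\<bar>) \<le> exp (- s * y) + exp (s * y)"
      "exp (t * y) \<le> exp (- s * y) + exp (s * y)" by linarith+
  qed
  have I: "integrable M (\<lambda>x. exp (- s * Y x) + exp (s * Y x))" using assms by simp
  show "integrable M (\<lambda>x. exp (t * Y x))"
    by (rule Bochner_Integration.integrable_bound[OF I]) (use *(2) in \<open>auto simp: add_nonneg_nonneg\<close>)
  show "integrable M (\<lambda>x. exp (t * \<bar>Y x\<bar>))"
    by (rule Bochner_Integration.integrable_bound[OF I]) (use *(1) in \<open>auto simp: add_nonneg_nonneg\<close>)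
qed

lemma expectation_exp_ge_1:
  fixes Y :: "'a \<Rightarrow> real"
  assumes "integrable M Y" "expectation Y = 0" "integrable M (\<lambda>x. exp (t * Y x))"
  shows "1 \<le> expectation (\<lambda>x. exp (t * Y x))"
proof -
  have "expectation (\<lambda>x. 1 + t * Y x) \<le> expectation (\<lambda>x. exp (t * Y x))"
    by (rule Bochner_Integration.integral_mono) (use assms in auto)
  then show ?thesis using assms by (simp add: prob_space)
qed

lemma cgf_nonneg:
  assumes "integrable M Y" "expectation Y = 0" "integrable M (\<lambda>x. exp (t * Y x))"
  shows "0 \<le> cgf Y t"
  by (rule ln_ge_zero[OF expectation_exp_ge_1[OF assms]])

text \<open>Centering removes the linear term, so the deviation from 1 is of order
  \<open>t^2\<close>. One half of the exponent \<open>c\<close> absorbs \<open>y^2\<close> and the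
  other half \<open>exp \<bar>t * y\<bar>\<close>, whence
  \<open>\<bar>t\<bar> \<le> c / 2\<close>.\<close>

lemma mgf_quadratic_bound:
  assumes [measurable]: "D \<in> borel_measurable M" and "0 < c"
    and fin: "(\<integral>\<^sup>+x. ennreal (exp (c * \<bar>D x\<bar>)) \<partial>M) \<le> 2"
    and D: "integrable M D" "expectation D = 0" and t: "\<bar>t\<bar> \<le> c / 2"
  shows "integrable M (\<lambda>x. exp (t * D x))" "expectation (\<lambda>x. exp (t * D x)) \<le> 1 + 16 / c\<^sup>2 * t\<^sup>2"
proof -
  have I: "integrable M (\<lambda>x. exp (c * \<bar>D x\<bar>))"
    by (rule integrableI_bounded) (use fin in \<open>auto intro: le_less_trans\<close>)
  have E: "expectation (\<lambda>x. exp (c * \<bar>D x\<bar>)) \<le> 2"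
    using fin by (subst (asm) nn_integral_eq_integral[OF I]) (auto simp flip: ennreal_numeral)
  have bound: "exp (t * y) \<le> 1 + t * y + 8 / c\<^sup>2 * t\<^sup>2 * exp (c * \<bar>y\<bar>)" for y
  proof -
    \<comment> \<open>The 8 is \<open>2^2 * fact 2\<close>, from the quadratic term of the
      exponential series at \<open>c * \<bar>y\<bar> / 2\<close>; the moment bound 2 turns it into
      16.\<close>
    have "y\<^sup>2 = 8 / c\<^sup>2 * ((c * \<bar>y\<bar> / 2) ^ 2 / fact 2)"
      using \<open>0 < c\<close> by (simp add: power_mult_distrib power_divide)
    also have "\<dots> \<le> 8 / c\<^sup>2 * exp (c * \<bar>y\<bar> / 2)"
      using \<open>0 < c\<close> by (intro mult_left_mono real_power_le_exp) auto
    finally have y2: "y\<^sup>2 \<le> 8 / c\<^sup>2 * exp (c * \<bar>y\<bar> / 2)" .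
    have "\<bar>t * y\<bar> \<le> c / 2 * \<bar>y\<bar>" using mult_right_mono[OF t, of "\<bar>y\<bar>"] by (simp add: abs_mult)
    then have "exp \<bar>t * y\<bar> \<le> exp (c * \<bar>y\<bar> / 2)" by simp
    then have "(t * y)\<^sup>2 * exp \<bar>t * y\<bar> \<le> (t\<^sup>2 * (8 / c\<^sup>2 * exp (c * \<bar>y\<bar> / 2))) * exp (c * \<bar>y\<bar> / 2)"
      using y2 unfolding power_mult_distrib by (intro mult_mono mult_left_mono) auto
    also have "\<dots> = 8 / c\<^sup>2 * t\<^sup>2 * exp (c * \<bar>y\<bar>)"
      by (simp add: exp_add[symmetric] mult_ac)
    finally show ?thesis using exp_quadratic_bound(1)[of "t * y"] by linarith
  qed
  have I': "integrable M (\<lambda>x. 1 + t * D x + 8 / c\<^sup>2 * t\<^sup>2 * exp (c * \<bar>D x\<bar>))" using I D by auto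
  show int: "integrable M (\<lambda>x. exp (t * D x))"
    by (rule Bochner_Integration.integrable_bound[OF I']) (use bound in \<open>auto intro: order_trans[OF _ abs_ge_self]\<close>)
  have "expectation (\<lambda>x. exp (t * D x)) \<le> expectation (\<lambda>x. 1 + t * D x + 8 / c\<^sup>2 * t\<^sup>2 * exp (c * \<bar>D x\<bar>))"
    using int I' bound by (intro Bochner_Integration.integral_mono) auto
  also have "\<dots> = 1 + 8 / c\<^sup>2 * t\<^sup>2 * expectation (\<lambda>x. exp (c * \<bar>D x\<bar>))"
    using I D by (simp add: prob_space)
  also have "\<dots> \<le> 1 + 8 / c\<^sup>2 * t\<^sup>2 * 2" using E by (intro add_left_mono mult_left_mono) auto
  finally show "expectation (\<lambda>x. exp (t * D x)) \<le> 1 + 16 / c\<^sup>2 * t\<^sup>2" by simp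
qed

lemma expectation_exp_pos:
  assumes "integrable M (\<lambda>x. exp (Y x :: real))"
  shows "0 < expectation (\<lambda>x. exp (Y x))"
  by (rule expectation_greater[OF assms]) simp

text \<open>Hoelder's inequality for \<open>U = V + (U - V)\<close>, with exponents \<open>1 + \<theta>\<close> and \<open>1 + 1 / \<theta>\<close>.\<close>

lemma cgf_perturbation:
  assumes [measurable]: "U \<in> borel_measurable M" "V \<in> borel_measurable M"
    and "0 < c" and fin: "(\<integral>\<^sup>+x. ennreal (exp (c * \<bar>U x - V x\<bar>)) \<partial>M) \<le> 2"
    and D: "integrable M (\<lambda>x. U x - V x)" "expectation (\<lambda>x. U x - V x) = 0"
    and "0 < \<theta>" and small: "\<bar>t\<bar> * (1 + 1 / \<theta>) \<le> c / 2"
    and V: "integrable M (\<lambda>x. exp ((1 + \<theta>) * t * V x))"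
  shows "integrable M (\<lambda>x. exp (t * U x))"
    "cgf U t \<le> cgf V ((1 + \<theta>) * t) / (1 + \<theta>) + 16 / c\<^sup>2 * (1 + 1 / \<theta>) * t\<^sup>2"
proof -
  \<comment> \<open>\<open>q\<close> is conjugate to \<open>1 + \<theta>\<close>, and the assumption
    \<open>small\<close> says that \<open>q * t\<close> stays in the range of the quadratic bound
    for the error.\<close>
  define q where "q = 1 + 1 / \<theta>"
  let ?D = "\<lambda>x. U x - V x"
  have "0 < q" using \<open>0 < \<theta>\<close> by (simp add: q_def add_pos_pos)
  have pq: "1 / (1 + \<theta>) + 1 / q = 1" "0 < 1 + \<theta>"
    using \<open>0 < \<theta>\<close> by (simp_all add: q_def field_simps)
  have qt: "\<bar>q * t\<bar> \<le> c / 2" using small \<open>0 < q\<close> by (simp add: q_def abs_mult mult.commute)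
  have [measurable]: "?D \<in> borel_measurable M" by measurable
  note QD = mgf_quadratic_bound[of ?D, OF _ \<open>0 < c\<close> fin D qt, simplified]
  define F G where "F = cgf V ((1 + \<theta>) * t)" and "G = cgf ?D (q * t)"
  have expF: "exp F = expectation (\<lambda>x. exp ((1 + \<theta>) * t * V x))"
    unfolding F_def using expectation_exp_pos[OF V] by simp
  have expG: "exp G = expectation (\<lambda>x. exp (q * t * ?D x))"
    unfolding G_def using expectation_exp_pos[OF QD(1)] by simp
  \<comment> \<open>Young's inequality from the convexity of \<open>exp\<close>. Each exponential is
    divided by its own expectation, so the right-hand side has expectation
    \<open>1 / (1 + \<theta>) + 1 / q = 1\<close>.\<close>
  have bound: "exp (t * U x - (F / (1 + \<theta>) + G / q)) \<le>
      (1 / (1 + \<theta>)) * (exp ((1 + \<theta>) * t * V x) / exp F) + (1 / q) * (exp (q * t * ?D x) / exp G)" for x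
  proof -
    let ?v = "(1 + \<theta>) * t * V x - F" and ?d = "q * t * ?D x - G"
    have "exp ((1 / (1 + \<theta>)) *\<^sub>R ?v + (1 / q) *\<^sub>R ?d) \<le> (1 / (1 + \<theta>)) * exp ?v + (1 / q) * exp ?d"
    proof -
      have "1 / (1 + \<theta>) = 1 - 1 / q" "0 \<le> 1 / q" "1 / q \<le> 1"
        using pq \<open>0 < q\<close> \<open>0 < \<theta>\<close> by (auto simp: q_def)
      then show ?thesis using convex_onD[OF exp_convex, of "1 / q" ?v ?d] by (simp only: UNIV_I)
    qed
    moreover have "(1 / (1 + \<theta>)) *\<^sub>R ?v + (1 / q) *\<^sub>R ?d = t * U x - (F / (1 + \<theta>) + G / q)"
    proof -
      have "(1 / (1 + \<theta>)) *\<^sub>R ?v = t * V x - F / (1 + \<theta>)" "(1 / q) *\<^sub>R ?d = t * ?D x - G / q"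
        using pq(2) \<open>0 < q\<close> by (simp_all add: field_simps)
      then show ?thesis by (simp add: algebra_simps)
    qed
    ultimately show ?thesis by (simp add: exp_diff)
  qed
  let ?B = "\<lambda>x. (1 / (1 + \<theta>)) * (exp ((1 + \<theta>) * t * V x) / exp F) + (1 / q) * (exp (q * t * ?D x) / exp G)"
  have IB: "integrable M ?B" using V QD(1)
    by (intro Bochner_Integration.integrable_add integrable_mult_right integrable_divide_zero) blast+
  have I: "integrable M (\<lambda>x. exp (t * U x - (F / (1 + \<theta>) + G / q)))"
    by (rule Bochner_Integration.integrable_bound[OF IB]) (use bound in \<open>auto intro: order_trans[OF _ abs_ge_self]\<close>)
  have eq: "exp (t * U x) = exp (F / (1 + \<theta>) + G / q) * exp (t * U x - (F / (1 + \<theta>) + G / q))" for x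
    by (simp add: exp_add[symmetric])
  show IU: "integrable M (\<lambda>x. exp (t * U x))"
    unfolding eq using I by (rule integrable_mult_right)
  have "expectation (\<lambda>x. exp (t * U x - (F / (1 + \<theta>) + G / q))) \<le> expectation ?B"
    using I IB bound by (rule Bochner_Integration.integral_mono)
  also have "\<dots> = 1 / (1 + \<theta>) + 1 / q"
    using V QD(1) by (simp add: expF[symmetric] expG[symmetric])
  finally have le1: "expectation (\<lambda>x. exp (t * U x - (F / (1 + \<theta>) + G / q))) \<le> 1" using pq by simp
  have "expectation (\<lambda>x. exp (t * U x)) =
      exp (F / (1 + \<theta>) + G / q) * expectation (\<lambda>x. exp (t * U x - (F / (1 + \<theta>) + G / q)))"
    unfolding eq by simp
  also have "\<dots> \<le> exp (F / (1 + \<theta>) + G / q)" using le1 by simp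
  finally have "cgf U t \<le> F / (1 + \<theta>) + G / q"
    using expectation_exp_pos[OF IU] by (metis exp_le_cancel_iff exp_ln)
  \<comment> \<open>Division by \<open>q\<close> cancels one of the two powers of \<open>q\<close>,
    so the error is linear in \<open>1 + 1 / \<theta>\<close>.\<close>
  also have "G / q \<le> 16 / c\<^sup>2 * (q * t)\<^sup>2 / q"
  proof (rule divide_right_mono)
    have "G \<le> ln (1 + 16 / c\<^sup>2 * (q * t)\<^sup>2)"
      unfolding G_def using QD expectation_exp_pos[OF QD(1)] by simp
    also have "\<dots> \<le> 16 / c\<^sup>2 * (q * t)\<^sup>2" by (intro ln_add_one_self_le_self) auto
    finally show "G \<le> 16 / c\<^sup>2 * (q * t)\<^sup>2" .
  qed (use \<open>0 < q\<close> in simp)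
  also have "16 / c\<^sup>2 * (q * t)\<^sup>2 / q = 16 / c\<^sup>2 * q * t\<^sup>2"
    using \<open>0 < q\<close> by (simp add: power2_eq_square)
  finally show "cgf U t \<le> cgf V ((1 + \<theta>) * t) / (1 + \<theta>) + 16 / c\<^sup>2 * (1 + 1 / \<theta>) * t\<^sup>2"
    by (simp add: F_def q_def)
qed

text \<open>The lower estimate needs finiteness of both summands from finiteness of the sum. Tonelli
  factors the nonnegative integral without assuming integrability.\<close>

lemma cgf_add_indep:
  assumes indep: "indep_var borel A borel B"
  shows "integrable M (\<lambda>x. exp (t * (A x + B x))) \<longleftrightarrow>
      integrable M (\<lambda>x. exp (t * A x)) \<and> integrable M (\<lambda>x. exp (t * B x))" (is "?I \<longleftrightarrow> ?A \<and> ?B")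
    and "integrable M (\<lambda>x. exp (t * (A x + B x))) \<Longrightarrow> cgf (\<lambda>x. A x + B x) t = cgf A t + cgf B t"
proof -
  have [measurable]: "A \<in> borel_measurable M" "B \<in> borel_measurable M"
    using indep indep_var_rv1 indep_var_rv2 by blast+
  have ind: "indep_var borel (\<lambda>x. exp (t * A x)) borel (\<lambda>x. exp (t * B x))"
    using indep_var_compose[OF indep, of "\<lambda>y. exp (t * y)" borel "\<lambda>y. exp (t * y)" borel]
    by (simp add: comp_def)
  have prod: "exp (t * (A x + B x)) = exp (t * A x) * exp (t * B x)" for x
    by (simp add: exp_add[symmetric] algebra_simps)
  have "?A \<and> ?B" if ?I
  proof -
    interpret A: prob_space "distr M borel A" by (rule prob_space_distr) simp
    interpret B: prob_space "distr M borel B" by (rule prob_space_distr) simp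
    have J: "distr M borel A \<Otimes>\<^sub>M distr M borel B = distr M (borel \<Otimes>\<^sub>M borel) (\<lambda>x. (A x, B x))"
      using indep by (simp add: indep_var_distribution_eq)
    have "(\<integral>\<^sup>+x. ennreal (exp (t * (A x + B x))) \<partial>M) =
        (\<integral>\<^sup>+z. ennreal (exp (t * fst z)) * ennreal (exp (t * snd z)) \<partial>distr M (borel \<Otimes>\<^sub>M borel) (\<lambda>x. (A x, B x)))"
      by (subst nn_integral_distr) (auto simp: prod ennreal_mult)
    also have "\<dots> = (\<integral>\<^sup>+y. \<integral>\<^sup>+z. ennreal (exp (t * y)) * ennreal (exp (t * z)) \<partial>distr M borel B \<partial>distr M borel A)"
      unfolding J[symmetric] by (subst B.nn_integral_fst[symmetric]) auto
    also have "\<dots> = (\<integral>\<^sup>+y. ennreal (exp (t * y)) \<partial>distr M borel A) * (\<integral>\<^sup>+z. ennreal (exp (t * z)) \<partial>distr M borel B)"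
      by (simp add: nn_integral_cmult nn_integral_multc)
    also have "\<dots> = (\<integral>\<^sup>+x. ennreal (exp (t * A x)) \<partial>M) * (\<integral>\<^sup>+x. ennreal (exp (t * B x)) \<partial>M)"
      by (simp add: nn_integral_distr)
    finally have eq: "(\<integral>\<^sup>+x. ennreal (exp (t * (A x + B x))) \<partial>M) =
        (\<integral>\<^sup>+x. ennreal (exp (t * A x)) \<partial>M) * (\<integral>\<^sup>+x. ennreal (exp (t * B x)) \<partial>M)" .
    \<comment> \<open>Neither factor vanishes, so the convention \<open>0 * \<top> = 0\<close>
      cannot hide an infinite factor in a finite product.\<close>
    have nz: "(\<integral>\<^sup>+x. ennreal (exp (t * Y x)) \<partial>M) \<noteq> 0" if [measurable]: "Y \<in> borel_measurable M" for Y
      by (subst nn_integral_0_iff_AE) (auto simp: AE_False)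
    have "(\<integral>\<^sup>+x. ennreal (exp (t * (A x + B x))) \<partial>M) < \<top>"
      using that by (subst nn_integral_eq_integral) auto
    then have "(\<integral>\<^sup>+x. ennreal (exp (t * A x)) \<partial>M) < \<top>" "(\<integral>\<^sup>+x. ennreal (exp (t * B x)) \<partial>M) < \<top>"
      unfolding eq using nz[of A] nz[of B] by (auto simp: ennreal_mult_less_top)
    then show ?thesis by (auto intro!: integrableI_bounded)
  qed
  moreover have ?I if "?A" "?B"
    unfolding prod using indep_var_integrable[OF ind that] .
  ultimately show iff: "?I \<longleftrightarrow> ?A \<and> ?B" by blast
  show "cgf (\<lambda>x. A x + B x) t = cgf A t + cgf B t" if ?I
  proof -
    have AB: ?A ?B using that iff by auto
    show ?thesis unfolding prod indep_var_lebesgue_integral[OF ind AB]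
      using expectation_exp_pos[OF AB(1)] expectation_exp_pos[OF AB(2)] by (simp add: ln_mult)
  qed
qed

text \<open>The remainder depends on \<open>Y\<close> only through \<open>s\<close> and
  \<open>K\<close>, which makes the expansion uniform over lengths. \<open>B\<close> bounds the
  expectation of \<open>exp (s * \<bar>Y x\<bar>)\<close> by two one-sided moments, and
  \<open>tB\<close> keeps the argument of \<open>ln (1 + x)\<close> in the range where it is
  \<open>x\<close> up to \<open>x^2\<close>.\<close>

lemma cgf_second_order:
  assumes [measurable]: "Y \<in> borel_measurable M" and "0 < s"
    and bounds: "\<And>t. \<bar>t\<bar> \<le> s \<Longrightarrow> integrable M (\<lambda>x. exp (t * Y x)) \<and> cgf Y t \<le> K"
    and Y: "integrable M Y" "expectation Y = 0"
    and t: "t \<noteq> 0" "\<bar>t\<bar> \<le> s / 2" and B: "B = 2 * exp K" and tB: "t\<^sup>2 * (8 / s\<^sup>2 * B) \<le> 1"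
  shows "\<bar>cgf Y t / t\<^sup>2 - expectation (\<lambda>x. (Y x)\<^sup>2) / 2\<bar> \<le> \<bar>t\<bar> * (48 / s ^ 3 * B) + t\<^sup>2 * (8 / s\<^sup>2 * B)\<^sup>2"
proof -
  have I: "integrable M (\<lambda>x. exp (- s * Y x))" "integrable M (\<lambda>x. exp (s * Y x))"
    using bounds[of s] bounds[of "- s"] \<open>0 < s\<close> by auto
  have Is: "integrable M (\<lambda>x. exp (s * \<bar>Y x\<bar>))" and It: "integrable M (\<lambda>x. exp (t * Y x))"
    using integrable_exp_between[OF _ I] t \<open>0 < s\<close> by auto
  have le_K: "expectation (\<lambda>x. exp (u * Y x)) \<le> exp K" if "\<bar>u\<bar> \<le> s" for u
    using bounds[OF that] expectation_exp_pos[of "\<lambda>x. u * Y x"] by (metis exp_le_cancel_iff exp_ln)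
  have "expectation (\<lambda>x. exp (s * \<bar>Y x\<bar>)) \<le> expectation (\<lambda>x. exp (- s * Y x) + exp (s * Y x))"
  proof (rule Bochner_Integration.integral_mono[OF Is])
    show "exp (s * \<bar>Y x\<bar>) \<le> exp (- s * Y x) + exp (s * Y x)" for x
      by (cases "0 \<le> Y x") auto
  qed (use I in auto)
  also have "\<dots> \<le> B" using I le_K[of s] le_K[of "- s"] \<open>0 < s\<close> by (simp add: B)
  finally have EB: "expectation (\<lambda>x. exp (s * \<bar>Y x\<bar>)) \<le> B" .
  have exp_ty: "exp \<bar>t * y\<bar> \<le> exp (s * \<bar>y\<bar> / 2)" for y
  proof -
    have "\<bar>t * y\<bar> \<le> s / 2 * \<bar>y\<bar>" using mult_right_mono[OF t(2), of "\<bar>y\<bar>"] by (simp add: abs_mult)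
    then show ?thesis by simp
  qed
  have half: "exp (s * \<bar>y\<bar> / 2) * exp (s * \<bar>y\<bar> / 2) = exp (s * \<bar>y\<bar>)" for y
    by (simp add: exp_add[symmetric])
  have y2: "y\<^sup>2 \<le> 8 / s\<^sup>2 * exp (s * \<bar>y\<bar> / 2)" for y
  proof -
    have "y\<^sup>2 = 8 / s\<^sup>2 * ((s * \<bar>y\<bar> / 2) ^ 2 / fact 2)"
      using \<open>0 < s\<close> by (simp add: power_mult_distrib power_divide)
    also have "\<dots> \<le> 8 / s\<^sup>2 * exp (s * \<bar>y\<bar> / 2)"
      using \<open>0 < s\<close> by (intro mult_left_mono real_power_le_exp) auto
    finally show ?thesis .
  qed
  \<comment> \<open>As 8 is \<open>2^2 * fact 2\<close>, so 48 is \<open>2^3 * fact 3\<close>; again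
    half of the exponent is reserved for \<open>exp \<bar>t * y\<bar>\<close>.\<close>
  have y3: "\<bar>y\<bar> ^ 3 \<le> 48 / s ^ 3 * exp (s * \<bar>y\<bar> / 2)" for y
  proof -
    have "\<bar>y\<bar> ^ 3 = 48 / s ^ 3 * ((s * \<bar>y\<bar> / 2) ^ 3 / fact 3)"
      using \<open>0 < s\<close> by (simp add: power_mult_distrib power_divide fact_numeral)
    also have "\<dots> \<le> 48 / s ^ 3 * exp (s * \<bar>y\<bar> / 2)"
      using \<open>0 < s\<close> by (intro mult_left_mono real_power_le_exp) auto
    finally show ?thesis .
  qed
  have b2: "exp (t * y) \<le> 1 + t * y + t\<^sup>2 * (8 / s\<^sup>2) * exp (s * \<bar>y\<bar>)" for y
  proof -
    have "(t * y)\<^sup>2 * exp \<bar>t * y\<bar> \<le> (t\<^sup>2 * (8 / s\<^sup>2 * exp (s * \<bar>y\<bar> / 2))) * exp (s * \<bar>y\<bar> / 2)"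
      using y2 exp_ty unfolding power_mult_distrib by (intro mult_mono mult_left_mono) auto
    also have "\<dots> = t\<^sup>2 * (8 / s\<^sup>2) * exp (s * \<bar>y\<bar>)" by (simp only: half[symmetric] mult_ac)
    finally show ?thesis using exp_quadratic_bound(1)[of "t * y"] by linarith
  qed
  have b3: "\<bar>exp (t * y) - 1 - t * y - t\<^sup>2 / 2 * y\<^sup>2\<bar> \<le> \<bar>t\<bar> ^ 3 * (48 / s ^ 3) * exp (s * \<bar>y\<bar>)" for y
  proof -
    have "\<bar>t * y\<bar> ^ 3 * exp \<bar>t * y\<bar> \<le> (\<bar>t\<bar> ^ 3 * (48 / s ^ 3 * exp (s * \<bar>y\<bar> / 2))) * exp (s * \<bar>y\<bar> / 2)"
      using y3 exp_ty \<open>0 < s\<close> unfolding power_mult_distrib abs_mult by (intro mult_mono mult_left_mono) auto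
    also have "\<dots> = \<bar>t\<bar> ^ 3 * (48 / s ^ 3) * exp (s * \<bar>y\<bar>)" by (simp only: half[symmetric] mult_ac)
    finally show ?thesis using exp_quadratic_bound(2)[of "t * y"] by (simp add: power_mult_distrib)
  qed
  have I2: "integrable M (\<lambda>x. (Y x)\<^sup>2)"
  proof (rule Bochner_Integration.integrable_bound)
    show "integrable M (\<lambda>x. 8 / s\<^sup>2 * exp (s * \<bar>Y x\<bar>))" using Is by simp
    have "y\<^sup>2 \<le> 8 / s\<^sup>2 * exp (s * \<bar>y\<bar>)" for y
    proof -
      have "s * \<bar>y\<bar> / 2 \<le> s * \<bar>y\<bar>" using \<open>0 < s\<close> by simp
      then have "8 / s\<^sup>2 * exp (s * \<bar>y\<bar> / 2) \<le> 8 / s\<^sup>2 * exp (s * \<bar>y\<bar>)"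
        by (intro mult_left_mono) auto
      then show ?thesis using y2[of y] by (rule order_trans[rotated])
    qed
    then show "AE x in M. norm ((Y x)\<^sup>2) \<le> norm (8 / s\<^sup>2 * exp (s * \<bar>Y x\<bar>))" by simp
  qed simp
  \<comment> \<open>Two estimates of \<open>x\<close> follow: a crude one of order
    \<open>t^2\<close>, which controls the error of the logarithm, and a third-order one, which
    isolates the second moment.\<close>
  define x where "x = expectation (\<lambda>x. exp (t * Y x)) - 1"
  have "0 \<le> x" using expectation_exp_ge_1[OF Y It] by (simp add: x_def)
  have "expectation (\<lambda>x. exp (t * Y x)) \<le> expectation (\<lambda>x. 1 + t * Y x + t\<^sup>2 * (8 / s\<^sup>2) * exp (s * \<bar>Y x\<bar>))"
    using Is It Y b2 by (intro Bochner_Integration.integral_mono) auto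
  also have "\<dots> = 1 + t\<^sup>2 * (8 / s\<^sup>2) * expectation (\<lambda>x. exp (s * \<bar>Y x\<bar>))"
    using Is Y by (simp add: prob_space)
  also have "\<dots> \<le> 1 + t\<^sup>2 * (8 / s\<^sup>2) * B" using EB by (intro add_left_mono mult_left_mono) auto
  finally have x_le: "x \<le> t\<^sup>2 * (8 / s\<^sup>2 * B)" by (simp add: x_def)
  have "\<bar>expectation (\<lambda>x. exp (t * Y x) - 1 - t * Y x - t\<^sup>2 / 2 * (Y x)\<^sup>2)\<bar> \<le>
      expectation (\<lambda>x. \<bar>exp (t * Y x) - 1 - t * Y x - t\<^sup>2 / 2 * (Y x)\<^sup>2\<bar>)"
    by (rule integral_abs_bound)
  also have "\<dots> \<le> expectation (\<lambda>x. \<bar>t\<bar> ^ 3 * (48 / s ^ 3) * exp (s * \<bar>Y x\<bar>))"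
    using Is It Y I2 b3 by (intro Bochner_Integration.integral_mono) auto
  also have "\<dots> \<le> \<bar>t\<bar> ^ 3 * (48 / s ^ 3) * B"
    using EB \<open>0 < s\<close> by (simp add: mult_left_mono divide_right_mono)
  also have "expectation (\<lambda>x. exp (t * Y x) - 1 - t * Y x - t\<^sup>2 / 2 * (Y x)\<^sup>2) =
      x - t\<^sup>2 / 2 * expectation (\<lambda>x. (Y x)\<^sup>2)"
    using It Y I2 by (simp add: prob_space x_def)
  finally have x3: "\<bar>x - t\<^sup>2 / 2 * expectation (\<lambda>x. (Y x)\<^sup>2)\<bar> \<le> t\<^sup>2 * (\<bar>t\<bar> * (48 / s ^ 3 * B))"
    by (simp add: power3_eq_cube power2_eq_square mult_ac)
  have "\<bar>ln (1 + x) - x\<bar> \<le> x\<^sup>2"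
    using \<open>0 \<le> x\<close> x_le tB by (intro abs_ln_one_plus_x_minus_x_bound_nonneg) auto
  also have "\<dots> \<le> (t\<^sup>2 * (8 / s\<^sup>2 * B))\<^sup>2" using \<open>0 \<le> x\<close> x_le by (intro power_mono) auto
  also have "\<dots> = t\<^sup>2 * (t\<^sup>2 * (8 / s\<^sup>2 * B)\<^sup>2)" by (simp add: power2_eq_square)
  finally have "\<bar>cgf Y t - t\<^sup>2 / 2 * expectation (\<lambda>x. (Y x)\<^sup>2)\<bar> \<le>
      t\<^sup>2 * (\<bar>t\<bar> * (48 / s ^ 3 * B) + t\<^sup>2 * (8 / s\<^sup>2 * B)\<^sup>2)"
    using x3 by (simp add: x_def distrib_left)
  then have "\<bar>cgf Y t - t\<^sup>2 / 2 * expectation (\<lambda>x. (Y x)\<^sup>2)\<bar> / t\<^sup>2 \<le>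
      \<bar>t\<bar> * (48 / s ^ 3 * B) + t\<^sup>2 * (8 / s\<^sup>2 * B)\<^sup>2"
    using t by (simp add: pos_divide_le_eq mult.commute)
  also have "\<bar>cgf Y t - t\<^sup>2 / 2 * expectation (\<lambda>x. (Y x)\<^sup>2)\<bar> / t\<^sup>2 =
      \<bar>cgf Y t / t\<^sup>2 - expectation (\<lambda>x. (Y x)\<^sup>2) / 2\<bar>"
  proof -
    have "cgf Y t / t\<^sup>2 - expectation (\<lambda>x. (Y x)\<^sup>2) / 2 =
        (cgf Y t - t\<^sup>2 / 2 * expectation (\<lambda>x. (Y x)\<^sup>2)) / t\<^sup>2"
      using t by (simp add: diff_divide_distrib)
    then show ?thesis by simp
  qed
  finally show ?thesis .
qed

end

section \<open>Splittable processes\<close>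

lemma
  fixes Y :: "'a \<Rightarrow> real" and Z :: "'b \<Rightarrow> real" and h :: "real \<Rightarrow> real"
  assumes [measurable]: "Y \<in> borel_measurable M" "Z \<in> borel_measurable N" "h \<in> borel_measurable borel"
    and eq: "distr M borel Y = distr N borel Z"
  shows distr_eq_integrable: "integrable M (\<lambda>x. h (Y x)) \<longleftrightarrow> integrable N (\<lambda>x. h (Z x))"
    and distr_eq_integral: "(\<integral>x. h (Y x) \<partial>M) = (\<integral>x. h (Z x) \<partial>N)"
proof -
  show "integrable M (\<lambda>x. h (Y x)) \<longleftrightarrow> integrable N (\<lambda>x. h (Z x))"
    using integrable_distr_eq[of Y M borel h] integrable_distr_eq[of Z N borel h] eq by simp
  show "(\<integral>x. h (Y x) \<partial>M) = (\<integral>x. h (Z x) \<partial>N)"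
    using integral_distr[of Y M borel h] integral_distr[of Z N borel h] eq by simp
qed

lemma identically_distributed_marginal:
  assumes id: "identically_distributed M X N Y" and "\<alpha> < \<beta>"
    and [measurable]: "X \<alpha> \<beta> \<in> borel_measurable M" "Y \<alpha> \<beta> \<in> borel_measurable N"
  shows "distr M borel (X \<alpha> \<beta>) = distr N borel (Y \<alpha> \<beta>)"
proof -
  let ?P = "PiM {..<1::nat} (\<lambda>_. borel :: real measure)"
  have "distr M ?P (\<lambda>\<omega>. \<lambda>i\<in>{..<1}. X \<alpha> \<beta> \<omega>) = distr N ?P (\<lambda>\<omega>. \<lambda>i\<in>{..<1}. Y \<alpha> \<beta> \<omega>)"
    using id[unfolded identically_distributed_def, rule_format, of 1 "\<lambda>_. \<alpha>" "\<lambda>_. \<beta>"] \<open>\<alpha> < \<beta>\<close> by simp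
  then have "distr (distr M ?P (\<lambda>\<omega>. \<lambda>i\<in>{..<1}. X \<alpha> \<beta> \<omega>)) borel (\<lambda>y. y 0) =
      distr (distr N ?P (\<lambda>\<omega>. \<lambda>i\<in>{..<1}. Y \<alpha> \<beta> \<omega>)) borel (\<lambda>y. y 0)" by (simp only:)
  then show ?thesis by (subst (asm) (1 2) distr_distr) (auto simp: comp_def)
qed

lemma independent_processes_indep_var:
  assumes "random_process N Y" "random_process N Z" "independent_processes N Y Z"
    and "\<alpha> < \<beta>" "\<gamma> < \<delta>"
  shows "prob_space.indep_var N borel (Y \<alpha> \<beta>) borel (Z \<gamma> \<delta>)"
proof -
  interpret prob_space N using assms(1) by (simp add: random_process_def)
  have "sigma_sets (space N) {Y \<alpha> \<beta> -` A \<inter> space N | A. A \<in> sets borel} \<subseteq> process_sigma_field N Y"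
    "sigma_sets (space N) {Z \<gamma> \<delta> -` A \<inter> space N | A. A \<in> sets borel} \<subseteq> process_sigma_field N Z"
    unfolding process_sigma_field_def using assms(4,5) by (intro sigma_sets_mono'; blast)+
  moreover have "indep_set (process_sigma_field N Y) (process_sigma_field N Z)"
    using assms(3) by (simp add: independent_processes_def)
  ultimately have "indep_set (sigma_sets (space N) {Y \<alpha> \<beta> -` A \<inter> space N | A. A \<in> sets borel})
      (sigma_sets (space N) {Z \<gamma> \<delta> -` A \<inter> space N | A. A \<in> sets borel})"
    unfolding indep_sets2_eq by blast
  then show ?thesis
    using assms(1,2,4,5) by (auto simp: indep_var_eq random_process_def)
qed

text \<open>
  Up to an error with a uniform exponential moment, the increment over \<open>[- a, b]\<close> is the sum of
  independent copies of the increments over \<open>[0, a]\<close> and \<open>[0, b]\<close>.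
\<close>

lemma splittable_cgf:
  assumes "splittable TYPE('b) M X"
  shows "\<exists>c>0. almost_additive_cgf (\<lambda>r l. ln (\<integral>\<omega>. exp (l * X 0 r \<omega>) \<partial>M))
    (\<lambda>r l. integrable M (\<lambda>\<omega>. exp (l * X 0 r \<omega>))) (16 / c\<^sup>2) (c / 2)"
proof -
  define f where "f r l = ln (\<integral>\<omega>. exp (l * X 0 r \<omega>) \<partial>M)" for r l
  define fin where "fin r l \<longleftrightarrow> integrable M (\<lambda>\<omega>. exp (l * X 0 r \<omega>))" for r l
  have X: "random_process M X" and centered: "centered_process M X" and stat: "stationary_process M X"
    using assms by (simp_all add: splittable_def)
  obtain N :: "'b measure" and X0 Xm Xp c where
    proc: "random_process N X0" "random_process N Xm" "random_process N Xp"
    and indep: "independent_processes N Xm Xp"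
    and id: "identically_distributed M X N X0" "identically_distributed M X N Xm"
      "identically_distributed M X N Xp" and "0 < c"
    and split: "\<And>a b. 0 < a \<Longrightarrow> 0 < b \<Longrightarrow>
       (\<integral>\<^sup>+\<omega>. ennreal (exp (c * \<bar>Xm (- a) 0 \<omega> - X0 (- a) 0 \<omega>\<bar> + c * \<bar>Xp 0 b \<omega> - X0 0 b \<omega>\<bar>)) \<partial>N) \<le> 2"
    using assms unfolding splittable_def by blast
  interpret M: prob_space M using X by (simp add: random_process_def)
  interpret N: prob_space N using proc(1) by (simp add: random_process_def)
  have X_meas: "X \<alpha> \<beta> \<in> borel_measurable M" if "\<alpha> < \<beta>" for \<alpha> \<beta>
    using X that by (simp add: random_process_def)
  have X_shift: "distr M borel (X (\<alpha> + s) (\<beta> + s)) = distr M borel (X \<alpha> \<beta>)" if "\<alpha> < \<beta>" for \<alpha> \<beta> s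
    using identically_distributed_marginal[of M "\<lambda>\<alpha> \<beta>. X (\<alpha> + s) (\<beta> + s)" M X \<alpha> \<beta>] stat that X_meas
    by (simp add: stationary_process_def)
  \<comment> \<open>Identical distribution leads from \<open>Y\<close> to \<open>X\<close>, and
    stationarity then moves the interval to start at 0.\<close>
  have Y_distr: "distr N borel (Y \<alpha> \<beta>) = distr M borel (X 0 (\<beta> - \<alpha>))"
    if "random_process N Y" "identically_distributed M X N Y" "\<alpha> < \<beta>" for Y \<alpha> \<beta>
    using identically_distributed_marginal[OF that(2,3)] that X_meas X_shift[of 0 "\<beta> - \<alpha>" \<alpha>]
    by (simp add: random_process_def)
  have Y_meas: "Y \<alpha> \<beta> \<in> borel_measurable N" if "random_process N Y" "\<alpha> < \<beta>" for Y \<alpha> \<beta>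
    using that by (simp add: random_process_def)
  have Y_fin: "integrable N (\<lambda>x. exp (t * Y \<alpha> \<beta> x)) \<longleftrightarrow> fin (\<beta> - \<alpha>) t"
    and Y_cgf: "N.cgf (Y \<alpha> \<beta>) t = f (\<beta> - \<alpha>) t"
    if "random_process N Y" "identically_distributed M X N Y" "\<alpha> < \<beta>" for Y \<alpha> \<beta> t
    unfolding fin_def f_def
    using distr_eq_integrable[OF Y_meas[OF that(1,3)] X_meas _ Y_distr[OF that], of "\<lambda>y. exp (t * y)"]
      distr_eq_integral[OF Y_meas[OF that(1,3)] X_meas _ Y_distr[OF that], of "\<lambda>y. exp (t * y)"] that
    by simp_all
  have Y_integrable: "integrable N (Y \<alpha> \<beta>)" and Y_centered: "N.expectation (Y \<alpha> \<beta>) = 0"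
    if "random_process N Y" "identically_distributed M X N Y" "\<alpha> < \<beta>" for Y \<alpha> \<beta>
    using distr_eq_integrable[OF Y_meas[OF that(1,3)] X_meas _ Y_distr[OF that], of "\<lambda>y. y"]
      distr_eq_integral[OF Y_meas[OF that(1,3)] X_meas _ Y_distr[OF that], of "\<lambda>y. y"] that centered
    by (simp_all add: centered_process_def)
  have bounds: "(\<bar>l\<bar> * (1 + 1 / \<theta>) \<le> c / 2 \<longrightarrow> fin a ((1 + \<theta>) * l) \<longrightarrow> fin b ((1 + \<theta>) * l) \<longrightarrow>
        fin (a + b) l \<and> f (a + b) l \<le>
          (f a ((1 + \<theta>) * l) + f b ((1 + \<theta>) * l)) / (1 + \<theta>) + 16 / c\<^sup>2 * (1 + 1 / \<theta>) * l\<^sup>2) \<and>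
      (\<bar>l\<bar> * (1 + 1 / \<theta>) \<le> c / 2 \<longrightarrow> fin (a + b) ((1 + \<theta>) * l) \<longrightarrow>
        fin a l \<and> fin b l \<and> f a l + f b l \<le>
          f (a + b) ((1 + \<theta>) * l) / (1 + \<theta>) + 16 / c\<^sup>2 * (1 + 1 / \<theta>) * l\<^sup>2)"
    if ab: "0 < a" "0 < b" and "0 < \<theta>" for a b \<theta> l
  proof -
    define A B where "A = Xm (- a) 0" and "B = Xp 0 b"
    \<comment> \<open>\<open>U\<close> is the increment of \<open>X0\<close> cut at 0 and
      \<open>V\<close> the independent sum. Viewing \<open>U\<close> as a perturbation of
      \<open>V\<close> gives the upper estimate, exchanging their roles the lower one.\<close>
    define U V where "U x = X0 (- a) 0 x + X0 0 b x" and "V x = A x + B x" for x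
    have [measurable]: "X0 (- a) 0 \<in> borel_measurable N" "X0 0 b \<in> borel_measurable N"
      "X0 (- a) b \<in> borel_measurable N" "A \<in> borel_measurable N" "B \<in> borel_measurable N"
      using Y_meas proc ab by (simp_all add: A_def B_def)
    have [measurable]: "U \<in> borel_measurable N" "V \<in> borel_measurable N"
      unfolding U_def[abs_def] V_def[abs_def] by measurable
    have int: "integrable N (X0 (- a) 0)" "integrable N (X0 0 b)" "integrable N A" "integrable N B"
      using Y_integrable proc id ab by (simp_all add: A_def B_def)
    have zero: "N.expectation (X0 (- a) 0) = 0" "N.expectation (X0 0 b) = 0"
      "N.expectation A = 0" "N.expectation B = 0"
      using Y_centered proc id ab by (simp_all add: A_def B_def)
    have UV: "integrable N (\<lambda>x. U x - V x)" "N.expectation (\<lambda>x. U x - V x) = 0"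
      using int zero by (simp_all add: U_def V_def)
    then have VU: "integrable N (\<lambda>x. V x - U x)" "N.expectation (\<lambda>x. V x - U x) = 0"
      using int zero by (simp_all add: U_def V_def)
    have "(\<integral>\<^sup>+x. ennreal (exp (c * \<bar>U x - V x\<bar>)) \<partial>N) \<le>
        (\<integral>\<^sup>+x. ennreal (exp (c * \<bar>Xm (- a) 0 x - X0 (- a) 0 x\<bar> + c * \<bar>Xp 0 b x - X0 0 b x\<bar>)) \<partial>N)"
    proof (intro nn_integral_mono ennreal_leI)
      fix x
      have "c * \<bar>U x - V x\<bar> \<le> c * (\<bar>Xm (- a) 0 x - X0 (- a) 0 x\<bar> + \<bar>Xp 0 b x - X0 0 b x\<bar>)"
        using \<open>0 < c\<close> by (intro mult_left_mono) (auto simp: U_def V_def A_def B_def)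
      then show "exp (c * \<bar>U x - V x\<bar>) \<le>
          exp (c * \<bar>Xm (- a) 0 x - X0 (- a) 0 x\<bar> + c * \<bar>Xp 0 b x - X0 0 b x\<bar>)"
        by (simp add: distrib_left)
    qed
    also have "\<dots> \<le> 2" using split ab .
    finally have mom: "(\<integral>\<^sup>+x. ennreal (exp (c * \<bar>U x - V x\<bar>)) \<partial>N) \<le> 2" .
    then have mom': "(\<integral>\<^sup>+x. ennreal (exp (c * \<bar>V x - U x\<bar>)) \<partial>N) \<le> 2"
      by (simp add: abs_minus_commute)
    \<comment> \<open>Additivity holds only almost surely, so integrals of \<open>U\<close> and of
      the whole increment are compared through null sets.\<close>
    have AE_U: "AE x in N. U x = X0 (- a) b x"
      using proc(1) ab by (simp add: random_process_def U_def)
    have U: "integrable N (\<lambda>x. exp (t * U x)) \<longleftrightarrow> fin (a + b) t" "N.cgf U t = f (a + b) t" for t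
    proof -
      have AE: "AE x in N. exp (t * U x) = exp (t * X0 (- a) b x)"
        using AE_U by eventually_elim simp
      have "integrable N (\<lambda>x. exp (t * U x)) \<longleftrightarrow> integrable N (\<lambda>x. exp (t * X0 (- a) b x))"
        by (rule integrable_cong_AE[OF _ _ AE]) simp_all
      moreover have "N.expectation (\<lambda>x. exp (t * U x)) = N.expectation (\<lambda>x. exp (t * X0 (- a) b x))"
        by (rule integral_cong_AE[OF _ _ AE]) simp_all
      ultimately show "integrable N (\<lambda>x. exp (t * U x)) \<longleftrightarrow> fin (a + b) t" "N.cgf U t = f (a + b) t"
        using Y_fin[OF proc(1) id(1), of "- a" b t] Y_cgf[OF proc(1) id(1), of "- a" b t] ab
        by (simp_all add: add.commute)
    qed
    have ind: "N.indep_var borel A borel B"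
      unfolding A_def B_def using independent_processes_indep_var[OF proc(2,3) indep] ab by simp
    have A: "integrable N (\<lambda>x. exp (t * A x)) \<longleftrightarrow> fin a t" "N.cgf A t = f a t"
      and B: "integrable N (\<lambda>x. exp (t * B x)) \<longleftrightarrow> fin b t" "N.cgf B t = f b t" for t
      using Y_fin[OF proc(2) id(2), of "- a" 0 t] Y_cgf[OF proc(2) id(2), of "- a" 0 t]
        Y_fin[OF proc(3) id(3), of 0 b t] Y_cgf[OF proc(3) id(3), of 0 b t] ab
      by (simp_all add: A_def B_def)
    have V: "integrable N (\<lambda>x. exp (t * V x)) \<longleftrightarrow> fin a t \<and> fin b t"
      "integrable N (\<lambda>x. exp (t * V x)) \<Longrightarrow> N.cgf V t = f a t + f b t" for t
      using N.cgf_add_indep[OF ind, of t] by (simp_all add: V_def A B)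
    show ?thesis
    proof (intro conjI impI)
      assume l: "\<bar>l\<bar> * (1 + 1 / \<theta>) \<le> c / 2"
      { assume "fin a ((1 + \<theta>) * l)" "fin b ((1 + \<theta>) * l)"
        then have I: "integrable N (\<lambda>x. exp ((1 + \<theta>) * l * V x))" using V(1) by blast
        note P = N.cgf_perturbation[OF _ _ \<open>0 < c\<close> mom UV \<open>0 < \<theta>\<close> l I]
        show "fin (a + b) l" using P(1) U(1) by simp
        show "f (a + b) l \<le> (f a ((1 + \<theta>) * l) + f b ((1 + \<theta>) * l)) / (1 + \<theta>) + 16 / c\<^sup>2 * (1 + 1 / \<theta>) * l\<^sup>2"
          using P(2) unfolding U(2) V(2)[OF I] by simp }
      { assume "fin (a + b) ((1 + \<theta>) * l)"
        then have I: "integrable N (\<lambda>x. exp ((1 + \<theta>) * l * U x))" using U(1) by blast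
        note P = N.cgf_perturbation[OF _ _ \<open>0 < c\<close> mom' VU \<open>0 < \<theta>\<close> l I]
        have IV: "integrable N (\<lambda>x. exp (l * V x))" using P(1) by simp
        show "fin a l" "fin b l" using IV V(1) by auto
        show "f a l + f b l \<le> f (a + b) ((1 + \<theta>) * l) / (1 + \<theta>) + 16 / c\<^sup>2 * (1 + 1 / \<theta>) * l\<^sup>2"
          using P(2) unfolding U(2) V(2)[OF IV] by simp }
    qed
  qed
  have "almost_additive_cgf f fin (16 / c\<^sup>2) (c / 2)"
  proof
    show "0 < 16 / c\<^sup>2" "0 < c / 2" using \<open>0 < c\<close> by auto
    show "0 \<le> f r l" if "0 < r" "fin r l" for r l
      unfolding f_def using M.cgf_nonneg[of "X 0 r" l] centered that
      by (simp add: centered_process_def fin_def)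
  qed (use bounds in blast)+
  then show ?thesis unfolding f_def[abs_def] fin_def[abs_def] using \<open>0 < c\<close> by blast
qed

section \<open>Uniform expansion and conclusion\<close>

lemma uniform_second_order:
  assumes "random_process M X" "centered_process M X"
    and "0 < s" and bound: "\<And>r l. 0 < r \<Longrightarrow> r \<le> R \<Longrightarrow> \<bar>l\<bar> \<le> s \<Longrightarrow>
      integrable M (\<lambda>\<omega>. exp (l * X 0 r \<omega>)) \<and> ln (\<integral>\<omega>. exp (l * X 0 r \<omega>) \<partial>M) \<le> K"
    and "0 < (e::real)"
  shows "\<exists>d>0. \<forall>r l. 0 < r \<and> r \<le> R \<and> l \<noteq> 0 \<and> \<bar>l\<bar> \<le> d \<longrightarrow>
     integrable M (\<lambda>\<omega>. exp (l * X 0 r \<omega>)) \<and>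
     \<bar>ln (\<integral>\<omega>. exp (l * X 0 r \<omega>) \<partial>M) / l\<^sup>2 - (\<integral>\<omega>. (X 0 r \<omega>)\<^sup>2 \<partial>M) / 2\<bar> \<le> e"
proof -
  interpret prob_space M using assms(1) by (simp add: random_process_def)
  define B where "B = 2 * exp K"
  define p q where "p = 8 / s\<^sup>2 * B" and "q = 48 / s ^ 3 * B"
  have pq: "0 < p" "0 < q" using \<open>0 < s\<close> by (auto simp: p_def q_def B_def)
  \<comment> \<open>\<open>d \<le> 1\<close> gives \<open>l^2 \<le> d\<close>; \<open>s / 2\<close>
    and \<open>1 / p\<close> meet the hypotheses of \<open>cgf_second_order\<close>; the last entry
    brings its remainder below \<open>e\<close>.\<close>
  define d where "d = Min {1, s / 2, 1 / p, e / (q + p\<^sup>2)}"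
  have "0 < d" using pq \<open>0 < s\<close> \<open>0 < e\<close> by (simp add: d_def add_pos_pos)
  have "d \<le> 1" "d \<le> s / 2" "d \<le> 1 / p" "d \<le> e / (q + p\<^sup>2)"
    unfolding d_def by (rule Min_le; simp)+
  then have d: "d \<le> 1" "d \<le> s / 2" "d * p \<le> 1" "d * (q + p\<^sup>2) \<le> e"
    using pq by (simp_all add: pos_le_divide_eq add_pos_pos)
  have "integrable M (\<lambda>\<omega>. exp (l * X 0 r \<omega>)) \<and> \<bar>cgf (X 0 r) l / l\<^sup>2 - (\<integral>\<omega>. (X 0 r \<omega>)\<^sup>2 \<partial>M) / 2\<bar> \<le> e"
    if r: "0 < r" "r \<le> R" and l: "l \<noteq> 0" "\<bar>l\<bar> \<le> d" for r l
  proof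
    have "\<bar>l\<bar> \<le> s" using l d \<open>0 < s\<close> by linarith
    then show "integrable M (\<lambda>\<omega>. exp (l * X 0 r \<omega>))" using bound r by blast
    have X: "X 0 r \<in> borel_measurable M" "integrable M (X 0 r)" "expectation (X 0 r) = 0"
      using assms(1,2) r by (auto simp: random_process_def centered_process_def)
    have "\<bar>l\<bar> * \<bar>l\<bar> \<le> d * 1" using l d by (intro mult_mono) auto
    then have l2: "l\<^sup>2 \<le> d" by (simp add: power2_eq_square)
    then have "l\<^sup>2 * p \<le> d * p" using pq by (intro mult_right_mono) auto
    then have "l\<^sup>2 * p \<le> 1" using d by linarith
    then have "\<bar>cgf (X 0 r) l / l\<^sup>2 - (\<integral>\<omega>. (X 0 r \<omega>)\<^sup>2 \<partial>M) / 2\<bar> \<le> \<bar>l\<bar> * q + l\<^sup>2 * p\<^sup>2"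
      using cgf_second_order[OF X(1) \<open>0 < s\<close> bound[OF r] X(2,3) l(1) _ B_def] l d
      by (simp add: p_def q_def)
    also have "\<dots> \<le> d * q + d * p\<^sup>2"
      using l l2 pq by (intro add_mono mult_right_mono) auto
    also have "\<dots> \<le> e" using d by (simp add: distrib_left)
    finally show "\<bar>cgf (X 0 r) l / l\<^sup>2 - (\<integral>\<omega>. (X 0 r \<omega>)\<^sup>2 \<partial>M) / 2\<bar> \<le> e" .
  qed
  with \<open>0 < d\<close> show ?thesis by blast
qed

text \<open>Integrability is part of the conclusion because the integral of a non-integrable
  function is 0 by default, so the estimate alone would not express finiteness of the exponential
  moment.\<close>

theorem theorem1p6:
  fixes M :: "'a measure" and X :: "'a process"
  assumes "splittable TYPE('b) M X"
  shows "\<exists>L::real. \<forall>\<epsilon>>0. \<exists>R>0. \<exists>\<delta>>0. \<forall>r\<ge>R. \<forall>lam::real.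
           lam \<noteq> 0 \<and> \<bar>lam\<bar> * ln r \<le> \<delta> \<longrightarrow>
             integrable M (\<lambda>\<omega>. exp (lam * X 0 r \<omega>)) \<and>
             \<bar>1 / (r * lam\<^sup>2) * ln (\<integral>\<omega>. exp (lam * X 0 r \<omega>) \<partial>M) - L\<bar> \<le> \<epsilon>"
proof -
  define f where "f r l = ln (\<integral>\<omega>. exp (l * X 0 r \<omega>) \<partial>M)" for r l
  define fin where "fin r l \<longleftrightarrow> integrable M (\<lambda>\<omega>. exp (l * X 0 r \<omega>))" for r l
  have X: "random_process M X" and centered: "centered_process M X"
    using assms by (simp_all add: splittable_def)
  interpret M: prob_space M using X by (simp add: random_process_def)
  obtain c where "0 < c" and cgf: "almost_additive_cgf f fin (16 / c\<^sup>2) (c / 2)"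
    using splittable_cgf[OF assms] unfolding f_def[abs_def] fin_def[abs_def] by blast
  interpret almost_additive_cgf f fin "16 / c\<^sup>2" "c / 2" by (rule cgf)
  obtain r0 t where "0 < r0" "0 < t"
    and t: "(\<integral>\<^sup>+\<omega>. ennreal (exp (t * \<bar>X 0 r0 \<omega>\<bar>)) \<partial>M) < \<infinity>"
    using assms unfolding splittable_def by blast
  have [measurable]: "X 0 r0 \<in> borel_measurable M" using X \<open>0 < r0\<close> by (simp add: random_process_def)
  have It: "integrable M (\<lambda>\<omega>. exp (t * \<bar>X 0 r0 \<omega>\<bar>))"
    by (rule integrableI_bounded) (use t in auto)
  \<comment> \<open>The two-sided moment at the single length \<open>r0\<close> seeds
    \<open>locally_uniform_bound\<close>, which spreads it to all lengths up to any given
    one.\<close>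
  have init: "fin r0 l \<and> f r0 l \<le> ln (\<integral>\<omega>. exp (t * \<bar>X 0 r0 \<omega>\<bar>) \<partial>M)" if "\<bar>l\<bar> \<le> t" for l
  proof
    have le: "exp (l * X 0 r0 \<omega>) \<le> exp (t * \<bar>X 0 r0 \<omega>\<bar>)" for \<omega>
    proof -
      have "l * X 0 r0 \<omega> \<le> \<bar>l\<bar> * \<bar>X 0 r0 \<omega>\<bar>" unfolding abs_mult[symmetric] by (rule abs_ge_self)
      also have "\<dots> \<le> t * \<bar>X 0 r0 \<omega>\<bar>" using that by (intro mult_right_mono) auto
      finally show ?thesis by simp
    qed
    have I: "integrable M (\<lambda>\<omega>. exp (l * X 0 r0 \<omega>))"
      by (rule Bochner_Integration.integrable_bound[OF It]) (use le in auto)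
    then show "fin r0 l" by (simp add: fin_def)
    have "M.expectation (\<lambda>\<omega>. exp (l * X 0 r0 \<omega>)) \<le> M.expectation (\<lambda>\<omega>. exp (t * \<bar>X 0 r0 \<omega>\<bar>))"
      using I It le by (rule Bochner_Integration.integral_mono)
    then show "f r0 l \<le> ln (\<integral>\<omega>. exp (t * \<bar>X 0 r0 \<omega>\<bar>) \<partial>M)"
      unfolding f_def using M.expectation_exp_pos[OF I] M.expectation_exp_pos[OF It]
      by (subst ln_le_cancel_iff) auto
  qed
  have second_order: "\<exists>d>0. \<forall>r l. 0 < r \<and> r \<le> R \<and> l \<noteq> 0 \<and> \<bar>l\<bar> \<le> d \<longrightarrow>
      fin r l \<and> \<bar>f r l / l\<^sup>2 - (\<integral>\<omega>. (X 0 r \<omega>)\<^sup>2 \<partial>M) / 2\<bar> \<le> e" if "0 < e" for R e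
  proof -
    obtain s K where "0 < s" "\<And>r l. 0 < r \<Longrightarrow> r \<le> R \<Longrightarrow> \<bar>l\<bar> \<le> s \<Longrightarrow> fin r l \<and> f r l \<le> K"
      using locally_uniform_bound[OF \<open>0 < r0\<close> \<open>0 < t\<close> init, of R] by blast
    then show ?thesis unfolding f_def fin_def
      by (intro uniform_second_order[OF X centered _ _ that]) blast+
  qed
  \<comment> \<open>Since the increments are centered, half the second moment is half the
    variance.\<close>
  interpret almost_additive_cgf_taylor f fin "16 / c\<^sup>2" "c / 2" "\<lambda>r. (\<integral>\<omega>. (X 0 r \<omega>)\<^sup>2 \<partial>M) / 2"
    by unfold_locales (rule second_order)
  show ?thesis using g_limit by (simp add: g_def f_def fin_def)
qed

end
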